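(* Let $p\ge 3$ and $p_1\ge 5$ be any primes. Then for all nonnegative integers $n$ and $\alpha$ the following hold. (1) If $n\neq k(3k+1)/2$ for all $k\in\mathbb{Z}$, then $$v_0(p^{2\alpha}(96n+4))\equiv 0\pmod{27}.$$ (2) For every $i\in\{1,2,3,\ldots,p_1-1\}$, $$v_0(p^{2\alpha}p_1(96p_1n+96i+4p_1))\equiv 0\pmod{27}.$$ (3) For every integer $j\ge 0$ such that $24j+1$ is a quadratic nonresidue modulo $p_1$, $$v_0(p^{2\alpha}(96p_1n+96j+4))\equiv 0\pmod{27}.$$
   Context: The integer sequence $v_0(n)$, $n\ge 0$, is defined by the generating function (formal power series in $q$) $$\sum_{n=0}^\infty v_0(n)q^n=\sum_{n=0}^\infty \frac{q^{n^2}(-q;q^2)_n}{(q;q^2)_n},$$ where $(a;q)_0=1$ and $(a;q)_n=\prod_{i=1}^n(1-aq^{i-1})$ for $n\ge1$, so that $(-q;q^2)_n=\prod_{i=1}^n(1+q^{2i-1})$ and $(q;q^2)_n=\prod_{i=1}^n(1-q^{2i-1})$. *)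

theory Defs
  imports
    "HOL-Computational_Algebra.Formal_Power_Series"
    "HOL-Number_Theory.Residues"
begin

definition qpoch :: "'a :: comm_ring_1 \<Rightarrow> 'a \<Rightarrow> nat \<Rightarrow> 'a" where
  "qpoch a q n = (\<Prod>i=1..n. 1 - a * q ^ (i - 1))"

(* int is not a field, so there is no division on int fps. The denominator (q;q^2)_n has
   constant coefficient 1, and fps_right_inverse f 1 is then the multiplicative inverse of f;
   see qpoch_denominator_inverse. *)
definition v0_term :: "nat \<Rightarrow> int fps" where
  "v0_term n =
     fps_X ^ (n\<^sup>2) * qpoch (- fps_X) (fps_X ^ 2) n *
     fps_right_inverse (qpoch fps_X (fps_X ^ 2) n) 1"

(* The infinite sum is taken in the library topology of formal power series, in which
   convergence means that every coefficient is eventually constant; see v0_term_sums. *)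
definition v0 :: "nat \<Rightarrow> int" where
  "v0 n = fps_nth (\<Sum>m. v0_term m) n"

lemma qpoch_denominator_nth_0:
  "fps_nth (qpoch fps_X (fps_X ^ 2) n :: int fps) 0 = 1"
proof -
  have "fps_nth (\<Prod>i\<in>A. 1 - fps_X * (fps_X ^ 2) ^ (i - 1) :: int fps) 0 = 1"
    if "finite A" for A :: "nat set"
    using that by induction simp_all
  then show ?thesis
    by (simp add: qpoch_def)
qed

lemma qpoch_denominator_inverse:
  fixes n :: nat and D :: "int fps"
  defines "D \<equiv> qpoch fps_X (fps_X ^ 2) n"
  shows "D * fps_right_inverse D 1 = 1"
  by (rule fps_right_inverse) (simp add: D_def qpoch_denominator_nth_0)

lemma v0_term_nth_eq_0:
  assumes "k < n"
  shows "fps_nth (v0_term n) k = 0"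
proof -
  have "n \<le> n\<^sup>2"
    by (simp add: power2_eq_square)
  with assms have "k < n\<^sup>2"
    by linarith
  then show ?thesis
    by (simp add: v0_term_def mult.assoc fps_X_power_mult_nth)
qed

lemma v0_term_sums: "v0_term sums Abs_fps (\<lambda>k. \<Sum>n\<le>k. fps_nth (v0_term n) k)"
  unfolding sums_def
proof (rule tendsto_fpsI)
  fix k
  have "fps_nth (\<Sum>n<N. v0_term n) k = (\<Sum>n\<le>k. fps_nth (v0_term n) k)" if "k < N" for N
    unfolding fps_sum_nth using that
    by (intro sum.mono_neutral_right) (auto simp: v0_term_nth_eq_0)
  then show "\<forall>\<^sub>F N in sequentially. fps_nth (\<Sum>n<N. v0_term n) k =
      fps_nth (Abs_fps (\<lambda>k. \<Sum>n\<le>k. fps_nth (v0_term n) k)) k"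
    by (auto intro: eventually_mono[OF eventually_gt_at_top[of k]])
qed

lemma v0_eq_sum: "v0 k = (\<Sum>n\<le>k. fps_nth (v0_term n) k)"
  by (simp add: v0_def sums_unique[OF v0_term_sums, symmetric])

end

theory Submission
  imports Defs
begin

text \<open>
  The series \<open>h(g) = \<Sum>n. q^(n^2) (g + q) (g + q^3) \<dots> (g + q^(2n-1)) / ((1 - g q) (1 - g q^3) \<dots> (1 - g q^(2n-1)))\<close>
  is related to \<open>h(g q^2)\<close> by telescoping, and iterating this relation turns \<open>h(g) + h(-g) - 1\<close>
  into an infinite product. At \<open>g = 1\<close>, where \<open>h\<close> is the generating function of \<open>v0\<close>, one obtains
  \<open>2 \<Sum>n. v0(4n) q^n - 1 = \<phi>(q)^2 / \<phi>(-q)\<close>, and three dissections into even and odd exponents give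
  \<open>\<Sum>n. v0(32n+4) q^n = 3 \<psi>(q) + 512 q \<psi>(q)^9 / \<phi>(-q)^8\<close>.

  By the 3-dissections of theta functions, \<open>\<phi>(-q) = a - 2x\<close> and \<open>\<psi>(q) = s (a + x) / b\<close>, where
  \<open>a\<close>, \<open>b\<close>, \<open>s\<close> and \<open>x / q\<close> are series in \<open>q^3\<close>. Since
  \<open>(a + x) (a^2 + 2ax + 4x^2)\<close> is congruent to a series in \<open>q^3\<close> modulo 3, its powers
  can be controlled modulo 27: in \<open>q \<psi>(q)^9 / \<phi>(-q)^8\<close> the coefficients at \<open>3n\<close> vanish modulo 27, and
  those at \<open>9n + 1\<close> are the coefficients of \<open>\<psi>(q) + 9 q \<psi>(q^9)\<close>. As \<open>\<psi>(q)\<close> only has exponents \<open>n\<close>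
  with \<open>8n + 1\<close> a square, 27 divides \<open>v0(4N)\<close> whenever \<open>N\<close> is not a square and is of the form
  \<open>24m + 1\<close> or \<open>9(8k + 1)\<close>.
\<close>

section \<open>Dilations and sections of power series\<close>

text \<open>All three claims concern one situation: the argument of \<open>v0\<close> is
  \<open>4 p^(2 \<alpha>) M\<close> with \<open>M mod 24 = 1\<close> and \<open>M\<close> not a
  square, be it because \<open>n\<close> is not a generalised pentagonal number, because
  \<open>p1\<close> divides \<open>M\<close> exactly once, or because of a quadratic nonresidue. The
  second family \<open>9 (8 k + 1)\<close> is there for \<open>p = 3\<close>, the one odd prime
  whose square is not 1 modulo 24. The powers of 3 come from the two 3-dissections:
  \<open>a + x\<close> and \<open>a - 2 x\<close> differ by \<open>3 x\<close>, so that
  \<open>psi\<close> and \<open>phi_neg\<close> agree modulo 3 up to a factor that is a series in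
  \<open>q^3\<close>. The obstacle throughout is division, since coefficients are integers. A
  quotient is dissected by multiplying with conjugates of its denominator until the denominator is a
  series in \<open>q^2\<close>, \<open>q^3\<close>, ...; such a series passes through the extraction
  of a residue class like a scalar. Leftover factors with constant coefficient 1 are units and
  cancel even inside a congruence.\<close>

definition dilate :: "nat \<Rightarrow> int fps \<Rightarrow> int fps" where
  "dilate k F = fps_compose F (fps_X ^ k)"

definition section_fps :: "nat \<Rightarrow> nat \<Rightarrow> int fps \<Rightarrow> int fps" where
  "section_fps k r F = Abs_fps (\<lambda>n. fps_nth F (k * n + r))"

lemma section_fps_nth [simp]: "fps_nth (section_fps k r F) n = fps_nth F (k * n + r)"
  by (simp add: section_fps_def)

lemma dilate_nth: "k > 0 \<Longrightarrow> fps_nth (dilate k F) n = (if k dvd n then fps_nth F (n div k) else 0)"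
proof -
  assume k: "k > 0"
  have "fps_nth (dilate k F) n = (\<Sum>i\<in>{0..n}. if n = k * i then fps_nth F i else 0)"
    unfolding dilate_def fps_compose_nth power_mult[symmetric] by (intro sum.cong) auto
  also have "\<dots> = (if k dvd n then fps_nth F (n div k) else 0)"
  proof (cases "k dvd n")
    case True
    then obtain j where j: "n = k * j" by (elim dvdE)
    have "(\<Sum>i\<in>{0..n}. if n = k * i then fps_nth F i else 0) = (\<Sum>i\<in>{0..n}. if i = j then fps_nth F i else 0)"
      using k j by (intro sum.cong) auto
    also have "\<dots> = fps_nth F j" using k j by (subst sum.delta) auto
    finally show ?thesis using j k by simp
  next
    case False
    then have "n \<noteq> k * i" for i by auto
    with False show ?thesis by simp
  qed
  finally show ?thesis .
qed

lemma dilate_add: "dilate k (F + G) = dilate k F + dilate k G"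
  by (simp add: dilate_def fps_compose_add_distrib)

lemma dilate_diff: "dilate k (F - G) = dilate k F - dilate k G"
  by (simp add: dilate_def fps_compose_sub_distrib)

lemma dilate_mult: "k > 0 \<Longrightarrow> dilate k (F * G) = dilate k F * dilate k G"
  by (simp add: dilate_def fps_compose_mult_distrib)

lemma dilate_1 [simp]: "dilate k 1 = 1"
  by (simp add: dilate_def)

lemma dilate_numeral [simp]: "dilate k (numeral m) = numeral m"
  by (simp add: dilate_def flip: numeral_fps_const)

lemma dilate_power: "k > 0 \<Longrightarrow> dilate k (F ^ m) = dilate k F ^ m"
  by (induction m) (simp_all add: dilate_mult)

lemma dilate_X [simp]: "k > 0 \<Longrightarrow> dilate k fps_X = fps_X ^ k"
  by (simp add: dilate_def fps_X_fps_compose_startby0)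

lemma dilate_dilate: "k > 0 \<Longrightarrow> l > 0 \<Longrightarrow> dilate k (dilate l F) = dilate (k * l) F"
  by (rule fps_ext) (auto simp: dilate_nth div_mult2_eq elim!: dvdE)

lemmas dilate_simps = dilate_add dilate_diff dilate_mult dilate_power dilate_dilate

lemma section_fps_add: "section_fps k r (F + G) = section_fps k r F + section_fps k r G"
  by (rule fps_ext) simp

lemma fps_nth_numeral_mult [simp]: "fps_nth (numeral m * F) n = numeral m * fps_nth (F :: int fps) n"
  unfolding numeral_fps_const by simp

text \<open>Series in \<open>q^k\<close> act as scalars on each residue class of exponents modulo
  \<open>k\<close>. All extractions from quotients below rest on this.\<close>

lemma section_fps_dilate_mult:
  assumes "r < k"
  shows "section_fps k r (dilate k F * G) = F * section_fps k r G"
proof (rule fps_ext)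
  fix n
  have k: "k > 0" using assms by simp
  have "fps_nth (dilate k F * G) (k * n + r) =
      (\<Sum>i\<in>{0..k * n + r}. (if k dvd i then fps_nth F (i div k) else 0) * fps_nth G (k * n + r - i))"
    by (simp add: fps_mult_nth dilate_nth k)
  also have "\<dots> = (\<Sum>i\<in>(\<lambda>j. k * j) ` {0..n}. fps_nth F (i div k) * fps_nth G (k * n + r - i))"
  proof (rule sum.mono_neutral_cong_right)
    show "(\<lambda>j. k * j) ` {0..n} \<subseteq> {0..k * n + r}"
      by (auto intro!: trans_le_add1 mult_le_mono2)
    show "\<forall>i\<in>{0..k * n + r} - (\<lambda>j. k * j) ` {0..n}.
        (if k dvd i then fps_nth F (i div k) else 0) * fps_nth G (k * n + r - i) = 0"
    proof
      fix i assume i: "i \<in> {0..k * n + r} - (\<lambda>j. k * j) ` {0..n}"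
      have "\<not> k dvd i"
      proof
        assume "k dvd i"
        then obtain j where j: "i = k * j" by (elim dvdE)
        with i have "k * j \<le> k * n + r" "j > n" by auto
        have "k * (n + 1) \<le> k * j" using \<open>j > n\<close> by (intro mult_le_mono2) simp
        with \<open>k * j \<le> k * n + r\<close> show False using assms by simp
      qed
      then show "(if k dvd i then fps_nth F (i div k) else 0) * fps_nth G (k * n + r - i) = 0"
        by simp
    qed
  qed auto
  also have "\<dots> = (\<Sum>j\<in>{0..n}. fps_nth F j * fps_nth G (k * (n - j) + r))"
    by (subst sum.reindex)
       (use k in \<open>auto simp: inj_on_def diff_mult_distrib2 intro!: sum.cong arg_cong[where f = "fps_nth G"]\<close>)
  finally show "fps_nth (section_fps k r (dilate k F * G)) n = fps_nth (F * section_fps k r G) n"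
    by (simp add: fps_mult_nth)
qed

lemma section_fps_monom:
  assumes "r < k" "j < k"
  shows "section_fps k r (fps_X ^ j) = (if j = r then 1 else 0)"
proof (rule fps_ext)
  fix n
  have "k * n + r = j \<longleftrightarrow> n = 0 \<and> r = j"
  proof (cases n)
    case (Suc m)
    then have "k * n \<ge> k" by simp
    with Suc assms show ?thesis by linarith
  qed auto
  then show "fps_nth (section_fps k r (fps_X ^ j)) n = fps_nth (if j = r then 1 else 0) n"
    by auto
qed

lemma section_fps_X_dilate:
  assumes "r < k" "j < k"
  shows "section_fps k r (fps_X ^ j * dilate k F) = (if j = r then F else 0)"
  using section_fps_dilate_mult[OF assms(1), of F "fps_X ^ j"] section_fps_monom[OF assms] by (simp add: mult.commute)

lemma section_fps_dilate: "k > 0 \<Longrightarrow> section_fps k 0 (dilate k F) = F"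
  using section_fps_X_dilate[of 0 k 0 F] by simp

section \<open>Theta series and their dissections\<close>

definition theta_series :: "(int \<Rightarrow> int) \<Rightarrow> (int \<Rightarrow> int) \<Rightarrow> int fps" where
  "theta_series s e = Abs_fps (\<lambda>k. \<Sum>n | e n = int k. s n)"

text \<open>Guards \<open>theta_series\<close> against two default effects: a sum over an infinite
  level would be 0, and terms with negative exponents would be dropped.\<close>

definition finite_levels :: "(int \<Rightarrow> int) \<Rightarrow> bool" where
  "finite_levels e \<longleftrightarrow> (\<forall>k. finite {n. e n = k}) \<and> (\<forall>n. e n \<ge> 0)"

lemma finite_levelsI:
  assumes "\<And>n. \<bar>n\<bar> \<le> 2 * e n + 1" "\<And>n. e n \<ge> 0"
  shows "finite_levels e"
  unfolding finite_levels_def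
proof safe
  fix k
  have "n \<in> {-(2 * k + 1)..2 * k + 1}" if "e n = k" for n using assms(1)[of n] that by auto
  then have "{n. e n = k} \<subseteq> {-(2 * k + 1)..2 * k + 1}" by blast
  then show "finite {n. e n = k}" by (rule finite_subset) simp
qed (use assms in auto)

lemma theta_series_reindex:
  assumes "bij h"
  shows "theta_series (\<lambda>n. s (h n)) (\<lambda>n. e (h n)) = theta_series s e"
proof (rule fps_ext)
  fix k
  have "(\<Sum>n | e (h n) = int k. s (h n)) = (\<Sum>n | e n = int k. s n)"
  proof (rule sum.reindex_bij_betw)
    show "bij_betw h {n. e (h n) = int k} {n. e n = int k}"
      unfolding bij_betw_def
    proof
      show "inj_on h {n. e (h n) = int k}" using bij_is_inj[OF assms] by (auto intro: inj_on_subset)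
      show "h ` {n. e (h n) = int k} = {n. e n = int k}"
        using bij_is_surj[OF assms] by (auto simp: image_iff)
    qed
  qed
  then show "fps_nth (theta_series (\<lambda>n. s (h n)) (\<lambda>n. e (h n))) k = fps_nth (theta_series s e) k"
    by (simp add: theta_series_def)
qed

lemma theta_series_cong_bij:
  assumes "bij h" "\<And>n. s' n = s (h n)" "\<And>n. e' n = e (h n)"
  shows "theta_series s' e' = theta_series s e"
proof -
  have "s' = (\<lambda>n. s (h n))" "e' = (\<lambda>n. e (h n))"
    using assms(2,3) by auto
  then show ?thesis using theta_series_reindex[OF assms(1), of s e] by simp
qed

lemma fps_const_minus_1 [simp]: "fps_const (- 1 :: int) = - 1"
  by (simp flip: fps_const_neg)

lemma theta_series_scale: "theta_series (\<lambda>n. c * s n) e = fps_const c * theta_series s e"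
  by (rule fps_ext) (simp add: theta_series_def sum_distrib_left)

lemma theta_series_shift:
  assumes "finite_levels e"
  shows "theta_series s (\<lambda>n. int j + e n) = fps_X ^ j * theta_series s e"
proof (rule fps_ext)
  fix k
  have "{n. int j + e n = int k} = (if k < j then {} else {n. e n = int (k - j)})"
  proof (cases "k < j")
    case True
    have "int j + e n \<noteq> int k" for n
      using True assms by (smt (verit) finite_levels_def of_nat_less_iff)
    with True show ?thesis by auto
  next
    case False
    then show ?thesis by (auto simp: of_nat_diff)
  qed
  then show "fps_nth (theta_series s (\<lambda>n. int j + e n)) k = fps_nth (fps_X ^ j * theta_series s e) k"
    by (simp add: theta_series_def fps_X_power_mult_nth)
qed

lemma theta_series_dilate:
  assumes "k > 0"
  shows "theta_series s (\<lambda>n. int k * e n) = dilate k (theta_series s e)"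
proof (rule fps_ext)
  fix m
  have "{n. int k * e n = int m} = (if k dvd m then {n. e n = int (m div k)} else {})"
  proof (cases "k dvd m")
    case True
    then show ?thesis using assms by (auto elim!: dvdE)
  next
    case False
    have "int k * e n \<noteq> int m" for n
      using False by (metis dvd_triv_left int_dvd_int_iff)
    with False show ?thesis by auto
  qed
  then show "fps_nth (theta_series s (\<lambda>n. int k * e n)) m = fps_nth (dilate k (theta_series s e)) m"
    using assms by (simp add: theta_series_def dilate_nth)
qed

lemma theta_series_split:
  assumes "finite_levels e" "m > 0"
  shows "theta_series s e = (\<Sum>r<m. theta_series (\<lambda>n. s (int m * n + int r)) (\<lambda>n. e (int m * n + int r)))"
proof (rule fps_ext)
  fix k
  define S where "S r = {n. e n = int k \<and> n mod int m = int r}" for r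
  have "{n. e n = int k} = (\<Union>r<m. S r)"
  proof -
    have "\<exists>r<m. n mod int m = int r" for n
      using assms(2) by (intro exI[of _ "nat (n mod int m)"]) (auto simp: nat_less_iff)
    then show ?thesis by (auto simp: S_def)
  qed
  then have "(\<Sum>n | e n = int k. s n) = (\<Sum>r<m. \<Sum>n\<in>S r. s n)"
  proof (simp, intro sum.UNION_disjoint ballI impI)
    fix i assume "i \<in> {..<m}"
    show "finite (S i)" unfolding S_def
      by (rule finite_subset[of _ "{n. e n = int k}"]) (use assms(1) in \<open>auto simp: finite_levels_def\<close>)
  qed (auto simp: S_def)
  also have "\<dots> = (\<Sum>r<m. \<Sum>n | e (int m * n + int r) = int k. s (int m * n + int r))"
  proof (rule sum.cong)
    fix r assume "r \<in> {..<m}"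
    then have r: "r < m" by simp
    have "(\<Sum>n\<in>S r. s n) = (\<Sum>n\<in>(\<lambda>n. int m * n + int r) ` {n. e (int m * n + int r) = int k}. s n)"
    proof (rule sum.cong)
      show "S r = (\<lambda>n. int m * n + int r) ` {n. e (int m * n + int r) = int k}"
      proof (intro equalityI subsetI)
        fix n assume n: "n \<in> S r"
        then have "n = int m * (n div int m) + int r"
          by (metis (mono_tags, lifting) S_def mem_Collect_eq mult_div_mod_eq)
        with n show "n \<in> (\<lambda>n. int m * n + int r) ` {n. e (int m * n + int r) = int k}"
          by (intro image_eqI[of _ _ "n div int m"]) (auto simp: S_def)
      qed (use r in \<open>auto simp: S_def\<close>)
    qed simp
    also have "\<dots> = (\<Sum>n | e (int m * n + int r) = int k. s (int m * n + int r))"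
      using assms(2) by (subst sum.reindex) (auto simp: inj_on_def)
    finally show "(\<Sum>n\<in>S r. s n) = (\<Sum>n | e (int m * n + int r) = int k. s (int m * n + int r))" .
  qed simp
  finally show "fps_nth (theta_series s e) k =
      fps_nth (\<Sum>r<m. theta_series (\<lambda>n. s (int m * n + int r)) (\<lambda>n. e (int m * n + int r))) k"
    by (simp add: theta_series_def fps_sum_nth)
qed

definition alt_sgn :: "int \<Rightarrow> int" where
  "alt_sgn n = (if even n then 1 else - 1)"

text \<open>
  In Ramanujan's notation these are \<open>\<phi>(q)\<close>, \<open>\<phi>(-q)\<close>, \<open>\<psi>(q)\<close>, \<open>f(q, q^2)\<close> and \<open>f(-q, -q^5)\<close>. As \<open>n\<close> runs through
  the integers, \<open>2 n^2 - n\<close> runs through the triangular numbers once, so \<open>psi\<close> is not doubled.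
\<close>

definition phi :: "int fps" where "phi = theta_series (\<lambda>_. 1) (\<lambda>n. n\<^sup>2)"
definition phi_neg :: "int fps" where "phi_neg = theta_series alt_sgn (\<lambda>n. n\<^sup>2)"
definition psi :: "int fps" where "psi = theta_series (\<lambda>_. 1) (\<lambda>n. 2 * n\<^sup>2 - n)"
definition pent :: "int fps" where "pent = theta_series (\<lambda>_. 1) (\<lambda>n. n * (3 * n + 1) div 2)"
definition omega :: "int fps" where "omega = theta_series alt_sgn (\<lambda>n. 3 * n\<^sup>2 - 2 * n)"

lemma abs_le_square: "\<bar>n\<bar> \<le> (n::int)\<^sup>2"
proof (cases "n = 0")
  case False
  then have "\<bar>n\<bar> * 1 \<le> \<bar>n\<bar> * \<bar>n\<bar>" by (intro mult_left_mono) auto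
  then show ?thesis by (simp add: power2_eq_square abs_mult_self_eq)
qed simp

lemma abs_linear_bounds:
  assumes "\<bar>n\<bar> \<le> (m::int)"
  shows "\<bar>n\<bar> \<le> 2 * (2 * m - n) + 1" "0 \<le> 2 * m - n"
    "\<bar>n\<bar> \<le> 2 * (3 * m - 2 * n) + 1" "0 \<le> 3 * m - 2 * n"
    "\<bar>n\<bar> \<le> 2 * (6 * m - n) + 1" "0 \<le> 6 * m - n"
    "\<bar>n\<bar> \<le> 3 * m + n + 1" "0 \<le> 3 * m + n" "0 \<le> m + n"
  using assms by (auto simp: abs_le_iff)

lemmas quad_bounds = abs_linear_bounds[OF abs_le_square]

lemma finite_levels_square: "finite_levels (\<lambda>n. n\<^sup>2)"
proof (rule finite_levelsI)
  show "\<bar>n\<bar> \<le> 2 * n\<^sup>2 + 1" for n :: int using abs_le_square[of n] by linarith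
qed simp

lemma finite_levels_psi: "finite_levels (\<lambda>n. 2 * n\<^sup>2 - n)"
proof (rule finite_levelsI)
  fix n :: int
  show "\<bar>n\<bar> \<le> 2 * (2 * n\<^sup>2 - n) + 1" by (rule quad_bounds)
  show "0 \<le> 2 * n\<^sup>2 - n" by (rule quad_bounds)
qed

lemma finite_levelsI_half:
  assumes "\<And>n. 2 * e n = f n" "\<And>n. \<bar>n\<bar> \<le> f n + 1" "\<And>n. f n \<ge> 0"
  shows "finite_levels e"
proof (rule finite_levelsI)
  fix n
  show "\<bar>n\<bar> \<le> 2 * e n + 1" using assms(1,2)[of n] by simp
  show "0 \<le> e n" using assms(1,3)[of n] by simp
qed

lemma abs_le_half_square: "2 * \<bar>n\<bar> \<le> (n::int)\<^sup>2 + 1"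
proof -
  have "0 \<le> (\<bar>n\<bar> - 1)\<^sup>2" by simp
  then show ?thesis by (simp add: power2_eq_square algebra_simps abs_mult_self_eq)
qed

lemma finite_levels_tri: "finite_levels (\<lambda>n. n * (n + 1) div 2)"
proof (rule finite_levelsI_half)
  fix n :: int
  show "2 * (n * (n + 1) div 2) = n\<^sup>2 + n"
    by (simp add: power2_eq_square algebra_simps)
  show "\<bar>n\<bar> \<le> n\<^sup>2 + n + 1" using abs_le_half_square[of n] by linarith
  show "0 \<le> n\<^sup>2 + n" by (rule quad_bounds)
qed

lemma finite_levels_pent: "finite_levels (\<lambda>n. n * (3 * n + 1) div 2)"
proof (rule finite_levelsI_half)
  fix n :: int
  have "even (n * (3 * n + 1))" by simp
  then show "2 * (n * (3 * n + 1) div 2) = 3 * n\<^sup>2 + n"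
    by (simp add: power2_eq_square algebra_simps)
  show "\<bar>n\<bar> \<le> 3 * n\<^sup>2 + n + 1" by (rule quad_bounds)
  show "0 \<le> 3 * n\<^sup>2 + n" by (rule quad_bounds)
qed

lemma finite_levels_omega: "finite_levels (\<lambda>n. 3 * n\<^sup>2 - 2 * n)"
proof (rule finite_levelsI)
  fix n :: int
  show "\<bar>n\<bar> \<le> 2 * (3 * n\<^sup>2 - 2 * n) + 1" by (rule quad_bounds)
  show "0 \<le> 3 * n\<^sup>2 - 2 * n" by (rule quad_bounds)
qed

lemma finite_levels_6: "finite_levels (\<lambda>n. 6 * n\<^sup>2 - n)" "finite_levels (\<lambda>n. 6 * n\<^sup>2 + 7 * n + 2)"
proof -
  show "finite_levels (\<lambda>n. 6 * n\<^sup>2 - n)"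
  proof (rule finite_levelsI)
    fix n :: int
    show "\<bar>n\<bar> \<le> 2 * (6 * n\<^sup>2 - n) + 1" by (rule quad_bounds)
    show "0 \<le> 6 * n\<^sup>2 - n" by (rule quad_bounds)
  qed
  show "finite_levels (\<lambda>n. 6 * n\<^sup>2 + 7 * n + 2)"
  proof (rule finite_levelsI)
    fix n :: int
    have "n \<le> -2 \<or> n = -1 \<or> n \<ge> 0" by linarith
    then have *: "\<bar>n\<bar> \<le> 6 * n\<^sup>2 + 7 * n + 2"
    proof (elim disjE)
      assume "n \<le> -2"
      then have "2 * \<bar>n\<bar> \<le> \<bar>n\<bar> * \<bar>n\<bar>" by (intro mult_right_mono) auto
      then show ?thesis by (simp add: power2_eq_square)
    qed auto
    then show "0 \<le> 6 * n\<^sup>2 + 7 * n + 2" by linarith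
    with * show "\<bar>n\<bar> \<le> 2 * (6 * n\<^sup>2 + 7 * n + 2) + 1" by (auto simp: abs_le_iff)
  qed
qed

lemma bij_affine: "bij (\<lambda>n. c - n :: int)" "bij (\<lambda>n. n + c :: int)"
proof -
  show "bij (\<lambda>n. c - n :: int)"
    by (rule bij_betw_byWitness[where f' = "\<lambda>n. c - n"]) auto
  show "bij (\<lambda>n. n + c :: int)"
    by (rule bij_betw_byWitness[where f' = "\<lambda>n. n - c"]) auto
qed

lemma theta_series_shift_dilate:
  assumes "finite_levels e" "k > 0"
  shows "theta_series s (\<lambda>n. int j + int k * e n) = fps_X ^ j * dilate k (theta_series s e)"
proof -
  have sub: "{n. int k * e n = l} \<subseteq> {n. e n = l div int k}" for l
    using assms(2) by auto
  have "finite {n. int k * e n = l}" for l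
    using finite_subset[OF sub] assms(1) by (simp add: finite_levels_def)
  then have "finite_levels (\<lambda>n. int k * e n)"
    using assms(1) by (simp add: finite_levels_def)
  then show ?thesis using assms by (simp add: theta_series_shift theta_series_dilate)
qed

lemma tri_eq:
  "(2 * n) * (2 * n + 1) div 2 = n * (2 * n + 1)"
  "(2 * n + 1) * (2 * n + 1 + 1) div 2 = (2 * n + 1) * (n + 1)" for n :: int
proof -
  have "(2 * n + 1) * (2 * n + 1 + 1) = 2 * ((2 * n + 1) * (n + 1))"
    by (simp add: algebra_simps)
  then show "(2 * n + 1) * (2 * n + 1 + 1) div 2 = (2 * n + 1) * (n + 1)" by (simp only: nonzero_mult_div_cancel_left)
qed (simp add: mult.assoc)

text \<open>The involution \<open>n -> -1 - n\<close> fixes the exponent and swaps the parity of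
  \<open>n\<close>, so the even and the odd indices give two equal copies.\<close>

lemma theta_series_tri: "theta_series (\<lambda>_. 1) (\<lambda>n. n * (n + 1) div 2) = 2 * psi"
proof -
  have "theta_series (\<lambda>_. 1) (\<lambda>n. n * (n + 1) div 2) =
      theta_series (\<lambda>_. 1) (\<lambda>n. n * (2 * n + 1)) + theta_series (\<lambda>_. 1) (\<lambda>n. (2 * n + 1) * (n + 1))"
    unfolding tri_eq[symmetric]
    by (subst theta_series_split[OF finite_levels_tri, of 2]) (simp_all add: lessThan_nat_numeral lessThan_Suc add_ac)
  also have "theta_series (\<lambda>_. 1) (\<lambda>n. n * (2 * n + 1)) = psi"
    unfolding psi_def
    by (rule theta_series_cong_bij[OF bij_affine(1)[of 0]]) (auto simp: algebra_simps power2_eq_square)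
  also have "theta_series (\<lambda>_. 1) (\<lambda>n. (2 * n + 1) * (n + 1)) = psi"
    unfolding psi_def
    by (rule theta_series_cong_bij[OF bij_affine(2)[of 1]]) (auto simp: algebra_simps power2_eq_square)
  finally show ?thesis by simp
qed

text \<open>An odd square is 1 plus 8 times a triangular number. The weight \<open>c\<close> of the
  odd indices is 1 for \<open>phi\<close> and -1 for \<open>phi_neg\<close>.\<close>

lemma phi_dissect2_aux:
  assumes "\<And>n. s (2 * n) = 1" "\<And>n. s (2 * n + 1) = c"
  shows "theta_series s (\<lambda>n. n\<^sup>2) = dilate 4 phi + fps_const c * 2 * fps_X * dilate 8 psi"
proof -
  have "theta_series s (\<lambda>n. n\<^sup>2) = theta_series (\<lambda>_. 1) (\<lambda>n. int 0 + int 4 * n\<^sup>2) +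
      theta_series (\<lambda>_. c * 1) (\<lambda>n. int 1 + int 8 * (n * (n + 1) div 2))"
  proof -
    have "theta_series (\<lambda>n. s (2 * n)) (\<lambda>n. (2 * n)\<^sup>2) = theta_series (\<lambda>_. 1) (\<lambda>n. int 0 + int 4 * n\<^sup>2)"
      using assms by (simp add: power2_eq_square)
    moreover have "(2 * n + 1)\<^sup>2 = 1 + 8 * (n * (n + 1) div 2)" for n :: int
    proof -
      have "even (n * (n + 1))" by simp
      then obtain k where k: "n * (n + 1) = 2 * k" by (elim evenE)
      have "(2 * n + 1)\<^sup>2 = 1 + 4 * (n * (n + 1))" by (simp add: power2_eq_square algebra_simps)
      then show ?thesis unfolding k by simp
    qed
    then have "theta_series (\<lambda>n. s (2 * n + 1)) (\<lambda>n. (2 * n + 1)\<^sup>2) =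
        theta_series (\<lambda>_. c * 1) (\<lambda>n. int 1 + int 8 * (n * (n + 1) div 2))"
      using assms by simp
    ultimately show ?thesis
      by (subst theta_series_split[OF finite_levels_square, of 2]) (simp_all add: lessThan_nat_numeral lessThan_Suc add.commute)
  qed
  also have "\<dots> = dilate 4 phi + fps_const c * (fps_X * dilate 8 (2 * psi))"
    unfolding theta_series_scale theta_series_shift_dilate[OF finite_levels_square, of 4, simplified]
      theta_series_shift_dilate[OF finite_levels_tri zero_less_numeral] phi_def[symmetric] theta_series_tri
    using theta_series_shift_dilate[OF finite_levels_square, of 4 "\<lambda>_. 1" 0]
    by (simp flip: phi_def)
  finally show ?thesis by (simp add: dilate_simps mult_ac)
qed

lemma phi_dissect2: "phi = dilate 4 phi + 2 * fps_X * dilate 8 psi"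
  using phi_dissect2_aux[of "\<lambda>_. 1" 1] by (simp flip: phi_def)

lemma phi_neg_dissect2: "phi_neg = dilate 4 phi - 2 * fps_X * dilate 8 psi"
  using phi_dissect2_aux[of alt_sgn "-1"]
  by (simp add: alt_sgn_def flip: phi_neg_def)

lemma theta_series_split3: "theta_series s e = theta_series (\<lambda>n. s (3 * n)) (\<lambda>n. e (3 * n)) +
    theta_series (\<lambda>n. s (3 * n + 1)) (\<lambda>n. e (3 * n + 1)) + theta_series (\<lambda>n. s (3 * n + 2)) (\<lambda>n. e (3 * n + 2))"
  if "finite_levels e"
  by (subst theta_series_split[OF that, of 3]) (simp_all add: lessThan_nat_numeral lessThan_Suc add_ac)

text \<open>The classes of \<open>3 m + 1\<close> and \<open>3 m - 1\<close> are mirror images,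
  whence the factor 2; the sign is negative because both numbers have the parity opposite to that of
  \<open>m\<close>.\<close>

lemma phi_neg_dissect3: "phi_neg = dilate 9 phi_neg - 2 * fps_X * dilate 3 omega"
proof -
  have "theta_series (\<lambda>n. alt_sgn (3 * n)) (\<lambda>n. (3 * n)\<^sup>2) = theta_series alt_sgn (\<lambda>n. int 0 + int 9 * n\<^sup>2)"
    by (simp add: alt_sgn_def[abs_def] power2_eq_square)
  also have "\<dots> = dilate 9 phi_neg"
    by (subst theta_series_shift_dilate[OF finite_levels_square]) (simp_all add: phi_neg_def)
  finally have 0: "theta_series (\<lambda>n. alt_sgn (3 * n)) (\<lambda>n. (3 * n)\<^sup>2) = dilate 9 phi_neg" .
  have "theta_series (\<lambda>n. alt_sgn (3 * n + 1)) (\<lambda>n. (3 * n + 1)\<^sup>2) =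
      theta_series (\<lambda>n. - 1 * alt_sgn n) (\<lambda>n. int 1 + int 3 * (3 * n\<^sup>2 - 2 * n))"
    by (rule theta_series_cong_bij[OF bij_affine(1)[of 0]]) (auto simp: algebra_simps power2_eq_square alt_sgn_def)
  also have "\<dots> = - (fps_X * dilate 3 omega)"
    unfolding theta_series_scale by (subst theta_series_shift_dilate[OF finite_levels_omega]) (simp_all add: omega_def)
  finally have 1: "theta_series (\<lambda>n. alt_sgn (3 * n + 1)) (\<lambda>n. (3 * n + 1)\<^sup>2) = - (fps_X * dilate 3 omega)" .
  have "theta_series (\<lambda>n. alt_sgn (3 * n + 2)) (\<lambda>n. (3 * n + 2)\<^sup>2) =
      theta_series (\<lambda>n. - 1 * alt_sgn n) (\<lambda>n. int 1 + int 3 * (3 * n\<^sup>2 - 2 * n))"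
    by (rule theta_series_cong_bij[OF bij_affine(2)[of 1]]) (auto simp: algebra_simps power2_eq_square alt_sgn_def)
  also have "\<dots> = - (fps_X * dilate 3 omega)"
    unfolding theta_series_scale by (subst theta_series_shift_dilate[OF finite_levels_omega]) (simp_all add: omega_def)
  finally have 2: "theta_series (\<lambda>n. alt_sgn (3 * n + 2)) (\<lambda>n. (3 * n + 2)\<^sup>2) = - (fps_X * dilate 3 omega)" .
  show ?thesis
    by (subst phi_neg_def, subst theta_series_split3[OF finite_levels_square]) (simp only: 0 1 2, simp)
qed

text \<open>These two halves are what the indices 0 and 2 modulo 3 contribute to \<open>psi\<close>
  in \<open>psi_dissect3\<close>.\<close>

lemma pent_split: "pent = theta_series (\<lambda>_. 1) (\<lambda>n. 6 * n\<^sup>2 - n) + theta_series (\<lambda>_. 1) (\<lambda>n. 6 * n\<^sup>2 + 7 * n + 2)"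
proof -
  have "theta_series (\<lambda>_. 1) (\<lambda>n. (2 * n) * (3 * (2 * n) + 1) div 2) = theta_series (\<lambda>_. 1) (\<lambda>n. 6 * n\<^sup>2 - n)"
    by (rule theta_series_cong_bij[OF bij_affine(1)[of 0]]) (auto simp: algebra_simps power2_eq_square mult.assoc)
  moreover have "(2 * n + 1) * (3 * (2 * n + 1) + 1) div 2 = 6 * n\<^sup>2 + 7 * n + 2" for n :: int
  proof -
    have "(2 * n + 1) * (3 * (2 * n + 1) + 1) = 2 * (6 * n\<^sup>2 + 7 * n + 2)"
      by (simp add: algebra_simps power2_eq_square)
    then show ?thesis by simp
  qed
  ultimately show ?thesis
    by (subst pent_def, subst theta_series_split[OF finite_levels_pent, of 2])
       (simp_all add: lessThan_nat_numeral lessThan_Suc add.commute)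
qed

lemma psi_dissect3: "psi = dilate 3 pent + fps_X * dilate 9 psi"
proof -
  have "theta_series (\<lambda>_. 1) (\<lambda>n. 2 * (3 * n)\<^sup>2 - 3 * n) = theta_series (\<lambda>_. 1) (\<lambda>n. int 0 + int 3 * (6 * n\<^sup>2 - n))"
    by (simp add: power2_eq_square algebra_simps)
  also have "\<dots> = dilate 3 (theta_series (\<lambda>_. 1) (\<lambda>n. 6 * n\<^sup>2 - n))"
    by (subst theta_series_shift_dilate[OF finite_levels_6(1)]) simp_all
  finally have 0: "theta_series (\<lambda>_. 1) (\<lambda>n. 2 * (3 * n)\<^sup>2 - 3 * n) = dilate 3 (theta_series (\<lambda>_. 1) (\<lambda>n. 6 * n\<^sup>2 - n))" .
  have "theta_series (\<lambda>_. 1) (\<lambda>n. 2 * (3 * n + 1)\<^sup>2 - (3 * n + 1)) = theta_series (\<lambda>_. 1) (\<lambda>n. int 1 + int 9 * (2 * n\<^sup>2 - n))"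
    by (rule theta_series_cong_bij[OF bij_affine(1)[of 0]]) (auto simp: algebra_simps power2_eq_square)
  also have "\<dots> = fps_X * dilate 9 psi"
    by (subst theta_series_shift_dilate[OF finite_levels_psi]) (simp_all add: psi_def)
  finally have 1: "theta_series (\<lambda>_. 1) (\<lambda>n. 2 * (3 * n + 1)\<^sup>2 - (3 * n + 1)) = fps_X * dilate 9 psi" .
  have "theta_series (\<lambda>_. 1) (\<lambda>n. 2 * (3 * n + 2)\<^sup>2 - (3 * n + 2)) =
      theta_series (\<lambda>_. 1) (\<lambda>n. int 0 + int 3 * (6 * n\<^sup>2 + 7 * n + 2))"
    by (simp add: power2_eq_square algebra_simps)
  also have "\<dots> = dilate 3 (theta_series (\<lambda>_. 1) (\<lambda>n. 6 * n\<^sup>2 + 7 * n + 2))"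
    by (subst theta_series_shift_dilate[OF finite_levels_6(2)]) simp_all
  finally have 2: "theta_series (\<lambda>_. 1) (\<lambda>n. 2 * (3 * n + 2)\<^sup>2 - (3 * n + 2)) = dilate 3 (theta_series (\<lambda>_. 1) (\<lambda>n. 6 * n\<^sup>2 + 7 * n + 2))" .
  show ?thesis
    by (subst psi_def, subst theta_series_split3[OF finite_levels_psi])
       (simp only: 0 1 2 pent_split dilate_add, simp)
qed

text \<open>Completing the square: \<open>8 (2 k^2 - k) + 1 = (4 k - 1)^2\<close>. This is how
  nonsquares enter the argument.\<close>

lemma psi_nth_nonzero:
  assumes "fps_nth psi n \<noteq> 0"
  obtains m where "int (8 * n + 1) = m\<^sup>2"
proof -
  from assms have "{k. 2 * k\<^sup>2 - k = int n} \<noteq> {}"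
    unfolding psi_def theta_series_def by (metis fps_nth_Abs_fps sum.empty)
  then obtain k where "2 * k\<^sup>2 - k = int n" by blast
  then have "int (8 * n + 1) = (4 * k - 1)\<^sup>2"
    by (simp add: power2_eq_square algebra_simps)
  then show ?thesis by (rule that)
qed

section \<open>Infinite products and the Jacobi triple product\<close>

text \<open>Congruence modulo \<open>q^m\<close>. Limits of sums and products are taken by comparing
  with finite truncations for every \<open>m\<close>.\<close>

definition eq_upto :: "nat \<Rightarrow> int fps \<Rightarrow> int fps \<Rightarrow> bool" where
  "eq_upto m F G \<longleftrightarrow> (\<forall>k<m. fps_nth F k = fps_nth G k)"

lemma eq_upto_refl [simp]: "eq_upto m F F"
  by (simp add: eq_upto_def)

lemma eq_upto_sym: "eq_upto m F G \<Longrightarrow> eq_upto m G F"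
  by (simp add: eq_upto_def)

lemma eq_upto_trans [trans]: "eq_upto m F G \<Longrightarrow> eq_upto m G H \<Longrightarrow> eq_upto m F H"
  by (simp add: eq_upto_def)

lemma eq_upto_mult: "eq_upto m F G \<Longrightarrow> eq_upto m F' G' \<Longrightarrow> eq_upto m (F * F') (G * G')"
  by (auto simp: eq_upto_def fps_mult_nth intro!: sum.cong)

lemma eq_upto_add: "eq_upto m F G \<Longrightarrow> eq_upto m F' G' \<Longrightarrow> eq_upto m (F + F') (G + G')"
  by (auto simp: eq_upto_def)

lemma eq_upto_diff: "eq_upto m F G \<Longrightarrow> eq_upto m F' G' \<Longrightarrow> eq_upto m (F - F') (G - G')"
  by (auto simp: eq_upto_def)

lemma eq_upto_sum: "(\<And>i. i \<in> A \<Longrightarrow> eq_upto m (F i) (G i)) \<Longrightarrow> eq_upto m (sum F A) (sum G A)"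
  by (auto simp: eq_upto_def fps_sum_nth intro!: sum.cong)

lemma eq_upto_prod: "(\<And>i. i \<in> A \<Longrightarrow> eq_upto m (F i) (G i)) \<Longrightarrow> eq_upto m (prod F A) (prod G A)"
  by (induction A rule: infinite_finite_induct) (auto intro: eq_upto_mult)

lemma eq_upto_X_power: "m \<le> j \<Longrightarrow> eq_upto m (fps_X ^ j * F) 0"
  by (auto simp: eq_upto_def fps_X_power_mult_nth)

lemma eq_upto_imp_eq: "(\<And>m. eq_upto m F G) \<Longrightarrow> F = G"
  by (auto simp: eq_upto_def fps_eq_iff)

lemma unit_inverse:
  assumes "fps_nth (Q :: int fps) 0 = 1"
  obtains R where "Q * R = 1"
  using fps_right_inverse[of Q 1] assms by auto

lemma eq_upto_cancel:
  assumes "eq_upto m (F * Q) (G * Q)" "fps_nth Q 0 = 1"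
  shows "eq_upto m F G"
proof -
  obtain R where R: "Q * R = 1" using unit_inverse[OF assms(2)] .
  have "eq_upto m (F * Q * R) (G * Q * R)" using assms(1) by (rule eq_upto_mult) simp
  then show ?thesis by (simp add: mult.assoc R)
qed

definition qprod_fin :: "int \<Rightarrow> nat \<Rightarrow> nat \<Rightarrow> nat \<Rightarrow> int fps" where
  "qprod_fin c a b N = (\<Prod>i<N. 1 - fps_const c * fps_X ^ (a + b * i))"

text \<open>The infinite product \<open>(c q^a; q^b)\<close>. For \<open>b > 0\<close> the factors
  of index above \<open>n\<close> are 1 modulo \<open>q^(n+1)\<close>, so the coefficient at
  \<open>n\<close> is already final.\<close>

definition qprod :: "int \<Rightarrow> nat \<Rightarrow> nat \<Rightarrow> int fps" where
  "qprod c a b = Abs_fps (\<lambda>n. fps_nth (qprod_fin c a b (Suc n)) n)"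

lemma qprod_fin_eq_upto:
  assumes "b > 0" "m \<le> N" "m \<le> M"
  shows "eq_upto m (qprod_fin c a b N) (qprod_fin c a b M)"
proof -
  have *: "eq_upto m (qprod_fin c a b (m + k)) (qprod_fin c a b m)" for k
  proof (induction k)
    case (Suc k)
    have "m \<le> b * m" using assms(1) by simp
    also have "\<dots> \<le> a + b * (m + k)" by (simp add: algebra_simps)
    finally have "eq_upto m (fps_X ^ (a + b * (m + k)) * fps_const c) 0" by (rule eq_upto_X_power)
    then have "eq_upto m (1 - fps_const c * fps_X ^ (a + b * (m + k))) (1 - 0)"
      by (intro eq_upto_diff) (simp_all add: mult.commute)
    with Suc show ?case
      using eq_upto_mult[OF Suc] by (fastforce simp: qprod_fin_def)
  qed simp
  obtain k l where "N = m + k" "M = m + l" using assms by (metis le_Suc_ex)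
  then show ?thesis using *[of k] *[of l] by (metis eq_upto_sym eq_upto_trans)
qed

lemma qprod_eq_upto:
  assumes "b > 0" "m \<le> N"
  shows "eq_upto m (qprod c a b) (qprod_fin c a b N)"
  unfolding eq_upto_def
proof safe
  fix k assume "k < m"
  then have "eq_upto (Suc k) (qprod_fin c a b (Suc k)) (qprod_fin c a b N)"
    using assms by (intro qprod_fin_eq_upto) auto
  then show "fps_nth (qprod c a b) k = fps_nth (qprod_fin c a b N) k"
    by (simp add: qprod_def eq_upto_def)
qed

lemma qprod_fin_nth_0: "a > 0 \<Longrightarrow> fps_nth (qprod_fin c a b N) 0 = 1"
  by (induction N) (simp_all add: qprod_fin_def)

lemma qprod_nth_0 [simp]: "a > 0 \<Longrightarrow> fps_nth (qprod c a b) 0 = 1"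
  by (simp add: qprod_def qprod_fin_nth_0)

lemma qprod_nonzero [simp]: "a > 0 \<Longrightarrow> qprod c a b \<noteq> 0"
proof
  assume "a > 0" "qprod c a b = 0"
  then show False using qprod_nth_0[of a c b] by simp
qed

lemma qprod_fin_split2: "qprod_fin c a b (2 * N) = qprod_fin c a (2 * b) N * qprod_fin c (a + b) (2 * b) N"
  by (induction N) (simp_all add: qprod_fin_def algebra_simps)

lemma qprod_fin_split3:
  "qprod_fin c a b (3 * N) = qprod_fin c a (3 * b) N * qprod_fin c (a + b) (3 * b) N * qprod_fin c (a + 2 * b) (3 * b) N"
proof -
  have "(\<Prod>i<3 * N. f i) = (\<Prod>i<N. f (3 * i)) * (\<Prod>i<N. f (3 * i + 1)) * (\<Prod>i<N. f (3 * i + 2))"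
    for f :: "nat \<Rightarrow> int fps"
  proof (induction N)
    case (Suc N)
    have *: "3 * Suc N = Suc (Suc (Suc (3 * N)))" by simp
    show ?case unfolding * prod.lessThan_Suc Suc.IH by (simp add: mult_ac)
  qed simp
  then show ?thesis by (simp add: qprod_fin_def algebra_simps)
qed

lemma qprod_split2:
  assumes "b > 0"
  shows "qprod c a b = qprod c a (2 * b) * qprod c (a + b) (2 * b)"
proof (rule eq_upto_imp_eq)
  fix m
  have "eq_upto m (qprod c a b) (qprod_fin c a b (2 * m))" using assms by (intro qprod_eq_upto) auto
  also have "eq_upto m \<dots> (qprod c a (2 * b) * qprod c (a + b) (2 * b))"
    unfolding qprod_fin_split2 using assms by (intro eq_upto_mult eq_upto_sym[OF qprod_eq_upto]) auto
  finally show "eq_upto m (qprod c a b) \<dots>" .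
qed

lemma qprod_split3:
  assumes "b > 0"
  shows "qprod c a b = qprod c a (3 * b) * qprod c (a + b) (3 * b) * qprod c (a + 2 * b) (3 * b)"
proof (rule eq_upto_imp_eq)
  fix m
  have "eq_upto m (qprod c a b) (qprod_fin c a b (3 * m))" using assms by (intro qprod_eq_upto) auto
  also have "eq_upto m \<dots> (qprod c a (3 * b) * qprod c (a + b) (3 * b) * qprod c (a + 2 * b) (3 * b))"
    unfolding qprod_fin_split3 using assms by (intro eq_upto_mult eq_upto_sym[OF qprod_eq_upto]) auto
  finally show "eq_upto m (qprod c a b) \<dots>" .
qed

lemma qprod_fin_square: "qprod_fin 1 a b N * qprod_fin (- 1) a b N = qprod_fin 1 (2 * a) (2 * b) N"
  unfolding qprod_fin_def prod.distrib[symmetric]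
proof (intro prod.cong refl)
  fix i
  have "fps_X ^ (2 * a + 2 * b * i) = (fps_X ^ (a + b * i)) ^ 2"
    by (simp flip: power_mult add: algebra_simps)
  then show "(1 - fps_const 1 * fps_X ^ (a + b * i)) * (1 - fps_const (- 1) * fps_X ^ (a + b * i)) =
      1 - fps_const (1 :: int) * fps_X ^ (2 * a + 2 * b * i)"
    by (simp add: power2_eq_square algebra_simps)
qed

lemma qprod_square:
  assumes "b > 0"
  shows "qprod 1 a b * qprod (- 1) a b = qprod 1 (2 * a) (2 * b)"
proof (rule eq_upto_imp_eq)
  fix m
  have "eq_upto m (qprod 1 a b * qprod (- 1) a b) (qprod_fin 1 a b m * qprod_fin (- 1) a b m)"
    using assms by (intro eq_upto_mult qprod_eq_upto) auto
  also have "eq_upto m \<dots> (qprod 1 (2 * a) (2 * b))"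
    unfolding qprod_fin_square using assms by (intro eq_upto_sym[OF qprod_eq_upto]) auto
  finally show "eq_upto m (qprod 1 a b * qprod (- 1) a b) \<dots>" .
qed

section \<open>Gaussian binomials and the triple product\<close>

text \<open>The Gaussian binomial coefficient in base \<open>t\<close>, given by a Pascal rule
  instead of a quotient so that it makes sense in every commutative ring.\<close>

fun gbinom :: "'a :: comm_ring_1 \<Rightarrow> nat \<Rightarrow> nat \<Rightarrow> 'a" where
  "gbinom t n 0 = 1"
| "gbinom t 0 (Suc k) = 0"
| "gbinom t (Suc n) (Suc k) = gbinom t n k + t ^ Suc k * gbinom t n (Suc k)"

lemma gbinom_eq_0: "n < k \<Longrightarrow> gbinom t n k = 0"
  by (induction t n k rule: gbinom.induct) auto

text \<open>The mirror image of the defining Pascal rule. In the finite triple product this one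
  adjoins the factor \<open>1 + a * t ^ N\<close>, the defining one
  \<open>1 + b * t ^ N\<close>.\<close>

lemma gbinom_Suc_Suc':
  "gbinom t (Suc n) (Suc k) = t ^ (n - k) * gbinom t n k + gbinom t n (Suc k)"
proof (induction n arbitrary: k)
  case (Suc n)
  show ?case
  proof (cases "k \<le> n")
    case True
    show ?thesis
    proof (cases k)
      case 0
      have "gbinom t (Suc (Suc n)) (Suc k) = 1 + t * gbinom t (Suc n) (Suc 0)"
        using 0 by simp
      also have "gbinom t (Suc n) (Suc 0) = t ^ n + gbinom t n (Suc 0)"
        using Suc[of 0] by simp
      finally show ?thesis using 0 by (simp add: algebra_simps)
    next
      case (Suc l)
      then have "Suc n - k = n - l" "n - l = Suc (n - k)" using True by auto
      let ?g = "gbinom t n"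
      have "t ^ Suc k * t ^ (n - k) = t ^ Suc n"
        using True by (simp flip: power_add power_Suc)
      moreover have "t ^ (n - l) * t ^ k = t ^ Suc n"
        using True Suc by (simp flip: power_add power_Suc)
      ultimately have P: "t ^ Suc k * t ^ (n - k) = t ^ (n - l) * t ^ k" by simp
      have "gbinom t (Suc (Suc n)) (Suc k) = gbinom t (Suc n) k + t ^ Suc k * gbinom t (Suc n) (Suc k)"
        by simp
      also have "\<dots> = (t ^ (n - l) * ?g l + ?g k) + t ^ Suc k * (t ^ (n - k) * ?g k + ?g (Suc k))"
        using Suc.IH[of l] Suc.IH[of k] Suc by simp
      also have "\<dots> = t ^ (n - l) * ?g l + ?g k + (t ^ Suc k * t ^ (n - k)) * ?g k + t ^ Suc k * ?g (Suc k)"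
        by (simp only: distrib_left mult.assoc add.assoc)
      also have "\<dots> = t ^ (n - l) * (?g l + t ^ k * ?g k) + (?g k + t ^ Suc k * ?g (Suc k))"
        unfolding P by (simp only: distrib_left mult.assoc add_ac)
      also have "\<dots> = t ^ (n - l) * gbinom t (Suc n) k + gbinom t (Suc n) (Suc k)"
        using Suc by simp
      finally show ?thesis using \<open>Suc n - k = n - l\<close> by simp
    qed
  next
    case False
    then show ?thesis by (cases "k = Suc n") (simp_all add: gbinom_eq_0)
  qed
qed (cases k; simp)

text \<open>The quotient formula with denominators cleared. It shows that
  \<open>gbinom t (2 * N) j\<close> tends to the reciprocal of the Euler product when
  \<open>j\<close> and \<open>2 * N - j\<close> both grow.\<close>

lemma gbinom_fact:
  assumes "k \<le> n"
  shows "gbinom t n k * (\<Prod>i<k. 1 - t ^ Suc i) * (\<Prod>i<n - k. 1 - t ^ Suc i) = (\<Prod>i<n. 1 - t ^ Suc i)"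
  using assms
proof (induction t n k rule: gbinom.induct)
  case (3 t n k)
  let ?p = "\<lambda>n. \<Prod>i<n. 1 - t ^ Suc i"
  have k: "k \<le> n" using 3 by simp
  have 1: "gbinom t n k * ?p k * ?p (n - k) = ?p n" using 3 by simp
  \<comment> \<open>For \<open>k = n\<close> both sides are 0, the right one because of the factor
    \<open>1 - t ^ 0\<close>.\<close>
  have 2: "gbinom t n (Suc k) * ?p (Suc k) * ?p (n - k) = ?p n * (1 - t ^ (n - k))"
  proof (cases "k = n")
    case False
    then have *: "n - k = Suc (n - Suc k)" using k by simp
    have "?p (n - k) = ?p (n - Suc k) * (1 - t ^ (n - k))" unfolding * by simp
    moreover have "gbinom t n (Suc k) * ?p (Suc k) * ?p (n - Suc k) = ?p n" using 3 False by simp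
    ultimately show ?thesis by (simp only: mult.assoc[symmetric])
  qed (simp add: gbinom_eq_0)
  have "gbinom t (Suc n) (Suc k) * ?p (Suc k) * ?p (Suc n - Suc k) =
      gbinom t n k * ?p k * ?p (n - k) * (1 - t ^ Suc k) +
      t ^ Suc k * (gbinom t n (Suc k) * ?p (Suc k) * ?p (n - k))"
    by (simp add: algebra_simps)
  also have "\<dots> = ?p n * (1 - t ^ Suc k + t ^ Suc k * (1 - t ^ (n - k)))"
    unfolding 1 2 by (simp add: algebra_simps)
  also have "t ^ Suc k * (1 - t ^ (n - k)) = t ^ Suc k - t ^ Suc n"
    using k by (simp add: right_diff_distrib flip: power_add power_Suc)
  finally show ?case by simp
qed simp_all

text \<open>Here \<open>t = a b\<close> and \<open>T n\<close> plays the role of \<open>a^(n(n+1)/2) b^(n(n-1)/2)\<close>.\<close>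

lemma finite_triple_product:
  fixes a b t :: "'a :: comm_ring_1" and T :: "int \<Rightarrow> 'a"
  assumes a: "\<And>N i. i \<le> 2 * N \<Longrightarrow>
      a * t ^ N * T (int i - int N) = t ^ (2 * N - i) * T (int i + 1 - int N)"
    and b: "\<And>N j. b * t ^ N * T (int j - int N) = t ^ j * T (int j - int N - 1)"
    and T0: "T 0 = 1"
  shows "(\<Prod>i<N. (1 + a * t ^ i) * (1 + b * t ^ i)) =
    (\<Sum>j\<le>2 * N. gbinom t (2 * N) j * T (int j - int N))"
proof (induction N)
  case (Suc N)
  let ?g = "gbinom t"
  \<comment> \<open>The factor with \<open>a\<close> widens the range of indices of \<open>T\<close>
    by one at the top.\<close>
  have 1: "(1 + a * t ^ N) * (\<Sum>j\<le>2 * N. ?g (2 * N) j * T (int j - int N)) =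
      (\<Sum>j\<le>Suc (2 * N). ?g (Suc (2 * N)) j * T (int j - int N))"
  proof -
    have "(\<Sum>j\<le>Suc (2 * N). ?g (Suc (2 * N)) j * T (int j - int N)) =
        T (- int N) + (\<Sum>i\<le>2 * N. ?g (Suc (2 * N)) (Suc i) * T (int (Suc i) - int N))"
      by (subst sum.atMost_Suc_shift) simp
    also have "\<dots> = T (- int N) + (\<Sum>i\<le>2 * N. ?g (2 * N) (Suc i) * T (int (Suc i) - int N)) +
        (\<Sum>i\<le>2 * N. ?g (2 * N) i * (t ^ (2 * N - i) * T (int i + 1 - int N)))"
      unfolding gbinom_Suc_Suc' by (simp add: sum.distrib algebra_simps)
    also have "T (- int N) + (\<Sum>i\<le>2 * N. ?g (2 * N) (Suc i) * T (int (Suc i) - int N)) =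
        (\<Sum>j\<le>Suc (2 * N). ?g (2 * N) j * T (int j - int N))"
      by (subst sum.atMost_Suc_shift) simp
    also have "\<dots> = (\<Sum>j\<le>2 * N. ?g (2 * N) j * T (int j - int N))"
      by (simp add: gbinom_eq_0)
    also have "(\<Sum>i\<le>2 * N. ?g (2 * N) i * (t ^ (2 * N - i) * T (int i + 1 - int N))) =
        (\<Sum>i\<le>2 * N. ?g (2 * N) i * (a * t ^ N * T (int i - int N)))"
      using a by (intro sum.cong) auto
    finally show ?thesis by (subst distrib_right) (simp only: mult_1 sum_distrib_left mult_ac)
  qed
  \<comment> \<open>The factor with \<open>b\<close> widens it by one at the bottom; recentring at
    \<open>Suc N\<close> makes the range symmetric again.\<close>
  have 2: "(1 + b * t ^ N) * (\<Sum>j\<le>Suc (2 * N). ?g (Suc (2 * N)) j * T (int j - int N)) =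
      (\<Sum>j\<le>Suc (Suc (2 * N)). ?g (Suc (Suc (2 * N))) j * T (int j - int (Suc N)))"
  proof -
    let ?h = "?g (Suc (2 * N))"
    have neg: "T (- 1 - int N) = T (- int N - 1)" by (rule arg_cong[where f = T]) simp
    have "(\<Sum>j\<le>Suc (Suc (2 * N)). ?g (Suc (Suc (2 * N))) j * T (int j - int (Suc N))) =
        T (- int N - 1) + (\<Sum>i\<le>Suc (2 * N). ?g (Suc (Suc (2 * N))) (Suc i) * T (int i - int N))"
      by (subst sum.atMost_Suc_shift) (simp add: algebra_simps neg del: gbinom.simps(3))
    also have "\<dots> = (\<Sum>i\<le>Suc (2 * N). ?h i * T (int i - int N)) +
       (T (- int N - 1) + (\<Sum>i\<le>Suc (2 * N). t ^ Suc i * ?h (Suc i) * T (int (Suc i) - int N - 1)))"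
      by (simp only: gbinom.simps(3)[of t "Suc (2 * N)"]) (simp add: sum.distrib algebra_simps del: gbinom.simps(3) power_Suc sum.atMost_Suc)
    also have "T (- int N - 1) + (\<Sum>i\<le>Suc (2 * N). t ^ Suc i * ?h (Suc i) * T (int (Suc i) - int N - 1)) =
       (\<Sum>j\<le>Suc (Suc (2 * N)). t ^ j * ?h j * T (int j - int N - 1))"
      by (subst (2) sum.atMost_Suc_shift) simp
    also have "\<dots> = (\<Sum>j\<le>Suc (2 * N). t ^ j * ?h j * T (int j - int N - 1))"
      by (subst sum.atMost_Suc) (simp add: gbinom_eq_0 del: gbinom.simps)
    also have "\<dots> = (\<Sum>j\<le>Suc (2 * N). ?h j * (b * t ^ N * T (int j - int N)))"
      unfolding b by (simp add: mult_ac)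
    finally show ?thesis
      by (subst distrib_right) (simp only: mult_1 sum_distrib_left mult_ac)
  qed
  have "(\<Prod>i<Suc N. (1 + a * t ^ i) * (1 + b * t ^ i)) =
      (1 + b * t ^ N) * ((1 + a * t ^ N) * (\<Sum>j\<le>2 * N. ?g (2 * N) j * T (int j - int N)))"
    using Suc by (simp add: mult_ac)
  also have "\<dots> = (\<Sum>j\<le>2 * Suc N. ?g (2 * Suc N) j * T (int j - int (Suc N)))"
    unfolding 1 2 by simp
  finally show ?case .
qed (simp add: T0)

text \<open>With \<open>theta_sgn\<close> this encodes Ramanujan's
  \<open>f(\<epsilon> q^c, \<epsilon> q^d)\<close> for \<open>\<epsilon> = 1\<close> or
  \<open>-1\<close>: the two triangular exponents of \<open>\<epsilon>\<close> add up to
  \<open>n^2\<close>, which has the parity of \<open>n\<close>.\<close>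

definition theta_exp :: "nat \<Rightarrow> nat \<Rightarrow> int \<Rightarrow> int" where
  "theta_exp c d n = int c * (n * (n + 1) div 2) + int d * (n * (n - 1) div 2)"

definition theta_sgn :: "int \<Rightarrow> int \<Rightarrow> int" where
  "theta_sgn \<epsilon> n = (if even n then 1 else \<epsilon>)"

lemma theta_exp_double: "2 * theta_exp c d n = int c * (n\<^sup>2 + n) + int d * (n\<^sup>2 - n)"
proof -
  have "2 * (n * (n + 1) div 2) = n\<^sup>2 + n" "2 * (n * (n - 1) div 2) = n\<^sup>2 - n"
    by (simp_all add: power2_eq_square algebra_simps)
  then show ?thesis by (simp only: theta_exp_def distrib_left[of 2] mult.left_commute[of 2])
qed

lemma theta_exp_diff: "theta_exp c d (n + 1) = theta_exp c d n + int c * (n + 1) + int d * n"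
proof -
  have "2 * theta_exp c d (n + 1) = 2 * (theta_exp c d n + int c * (n + 1) + int d * n)"
    unfolding theta_exp_double distrib_left[of 2] by (simp add: power2_eq_square algebra_simps)
  then show ?thesis by simp
qed

lemma theta_exp_ge:
  assumes "c > 0" "d > 0"
  shows "n\<^sup>2 \<le> theta_exp c d n"
proof -
  have "n\<^sup>2 + n \<le> int c * (n\<^sup>2 + n)" "n\<^sup>2 - n \<le> int d * (n\<^sup>2 - n)"
    using abs_le_square[of n] assms by (simp_all add: mult_le_cancel_right1 abs_le_iff)
  then have "2 * n\<^sup>2 \<le> 2 * theta_exp c d n" unfolding theta_exp_double by linarith
  then show ?thesis by simp
qed

text \<open>The limit of the finite identity, multiplied by the Euler product \<open>Q\<close>: in
  the inner terms \<open>Q\<close> cancels the Gaussian binomial, and the outer terms have exponents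
  beyond the precision because \<open>theta_exp\<close> grows quadratically.\<close>

theorem triple_product:
  assumes "c > 0" "d > 0" "\<epsilon> \<in> {1, - 1}"
  shows "theta_series (theta_sgn \<epsilon>) (theta_exp c d) =
    qprod (- \<epsilon>) c (c + d) * qprod (- \<epsilon>) d (c + d) * qprod 1 (c + d) (c + d)"
proof (rule eq_upto_imp_eq)
  fix m :: nat
  let ?s = "c + d"
  let ?e = "theta_exp c d"
  define t where "t = (fps_X ^ ?s :: int fps)"
  define T where "T n = fps_const (theta_sgn \<epsilon> n) * fps_X ^ nat (?e n)" for n
  define Q where "Q = qprod 1 ?s ?s"
  \<comment> \<open>With this choice each \<open>j\<close> is either at least \<open>m\<close> away
    from both ends of the range, where the Gaussian binomial has reached its limit, or at least
    \<open>m\<close> away from the centre, where the theta exponent is at least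
    \<open>m\<close>.\<close>
  define N where "N = 2 * m"
  have e_ge: "\<bar>n\<bar> \<le> ?e n" for n
    using theta_exp_ge[OF assms(1,2), of n] abs_le_square[of n] by simp
  then have e_nonneg: "?e n \<ge> 0" for n using abs_ge_zero order_trans by blast
  have \<epsilon>: "fps_const \<epsilon> * fps_const (theta_sgn \<epsilon> n) = fps_const (theta_sgn \<epsilon> (n + 1))" for n
    using assms(3) by (auto simp: theta_sgn_def)
  have a: "fps_const \<epsilon> * fps_X ^ c * t ^ N * T (int i - int N) =
      t ^ (2 * N - i) * T (int i + 1 - int N)" if "i \<le> 2 * N" for N i
  proof -
    from that obtain l where l: "2 * N = i + l" by (metis le_Suc_ex)
    then have i: "int i = 2 * int N - int l" by simp
    have "int c * int i = 2 * (int c * int N) - int c * int l"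
      "int d * int i = 2 * (int d * int N) - int d * int l"
      by (simp_all add: i right_diff_distrib)
    then have "c + ?s * N + nat (?e (int i - int N)) = ?s * l + nat (?e (int i + 1 - int N))"
      unfolding int_int_eq[symmetric]
      using e_nonneg theta_exp_diff[of c d "int i - int N"]
      by (simp add: algebra_simps)
    then have "c + ?s * N + nat (?e (int i - int N)) = ?s * (2 * N - i) + nat (?e (int i + 1 - int N))"
      unfolding l by simp
    then show ?thesis
      using \<epsilon>[of "int i - int N"]
      by (simp add: T_def t_def algebra_simps flip: power_mult power_add)
  qed
  have b: "fps_const \<epsilon> * fps_X ^ d * t ^ N * T (int j - int N) = t ^ j * T (int j - int N - 1)" for N j
  proof -
    have "d + ?s * N + nat (?e (int j - int N)) = ?s * j + nat (?e (int j - int N - 1))"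
      unfolding int_int_eq[symmetric]
      using e_nonneg theta_exp_diff[of c d "int j - int N - 1"]
      by (simp add: algebra_simps)
    then have X: "fps_X ^ (d + ?s * N + nat (?e (int j - int N))) =
        (fps_X ^ (?s * j + nat (?e (int j - int N - 1))) :: int fps)" by simp
    have C: "fps_const \<epsilon> * fps_const (theta_sgn \<epsilon> (int j - int N)) =
        fps_const (theta_sgn \<epsilon> (int j - int N - 1))"
      using assms(3) by (auto simp: theta_sgn_def)
    have "fps_const \<epsilon> * fps_X ^ d * t ^ N * T (int j - int N) =
        (fps_const \<epsilon> * fps_const (theta_sgn \<epsilon> (int j - int N))) *
        fps_X ^ (d + ?s * N + nat (?e (int j - int N)))"
      unfolding T_def t_def power_mult power_add by (simp only: mult_ac)
    also have "\<dots> = t ^ j * T (int j - int N - 1)"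
      unfolding C X unfolding T_def t_def power_mult power_add by (simp only: mult_ac)
    finally show ?thesis .
  qed
  have T0: "T 0 = 1" by (simp add: T_def theta_sgn_def theta_exp_def)
  have "qprod_fin (- \<epsilon>) c ?s N * qprod_fin (- \<epsilon>) d ?s N =
      (\<Prod>i<N. (1 + (fps_const \<epsilon> * fps_X ^ c) * t ^ i) * (1 + (fps_const \<epsilon> * fps_X ^ d) * t ^ i))"
    by (simp add: qprod_fin_def t_def prod.distrib power_add power_mult mult.assoc flip: fps_const_neg)
  also have "\<dots> = (\<Sum>j\<le>2 * N. gbinom t (2 * N) j * T (int j - int N))"
    by (rule finite_triple_product) (use a b T0 in auto)
  finally have fin: "qprod_fin (- \<epsilon>) c ?s N * qprod_fin (- \<epsilon>) d ?s N =
      (\<Sum>j\<le>2 * N. gbinom t (2 * N) j * T (int j - int N))" .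
  have Q0: "fps_nth Q 0 = 1" unfolding Q_def using assms by simp
  have qf: "(\<Prod>i<n. 1 - t ^ Suc i) = qprod_fin 1 ?s ?s n" for n
    by (simp add: qprod_fin_def t_def power_add power_mult)
  have Qf: "eq_upto m (qprod_fin 1 ?s ?s n) Q" if "m \<le> n" for n
    unfolding Q_def using that assms by (intro eq_upto_sym[OF qprod_eq_upto]) auto
  have lim: "eq_upto m (gbinom t (2 * N) j * T (int j - int N) * Q) (T (int j - int N))" if j: "j \<le> 2 * N" for j
  proof (cases "m \<le> j \<and> m \<le> 2 * N - j")
    case True
    \<comment> \<open>One \<open>Q\<close> stands for each factorial in the denominator; the
      numerator supplies a third copy, which cancels one of them.\<close>
    have "eq_upto m (gbinom t (2 * N) j * Q * Q) (gbinom t (2 * N) j * qprod_fin 1 ?s ?s j * qprod_fin 1 ?s ?s (2 * N - j))"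
      using True by (intro eq_upto_mult eq_upto_sym[OF Qf]) auto
    also have "\<dots> = qprod_fin 1 ?s ?s (2 * N)"
      using gbinom_fact[OF j, of t] unfolding qf .
    also have "eq_upto m \<dots> (1 * Q)"
      using Qf[of "2 * N"] by (simp add: N_def)
    finally have "eq_upto m (gbinom t (2 * N) j * Q) 1"
      by (rule eq_upto_cancel) (rule Q0)
    then have "eq_upto m (gbinom t (2 * N) j * Q * T (int j - int N)) (1 * T (int j - int N))"
      by (rule eq_upto_mult) simp
    then show ?thesis by (simp add: mult_ac)
  next
    case False
    then have "int m \<le> \<bar>int j - int N\<bar>" using j by (auto simp: N_def)
    then have "m \<le> nat (?e (int j - int N))" using e_ge[of "int j - int N"] by linarith
    then have "eq_upto m (fps_X ^ nat (?e (int j - int N)) * F) 0" for F by (rule eq_upto_X_power)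
    from this[of "fps_const (theta_sgn \<epsilon> (int j - int N)) * gbinom t (2 * N) j * Q"]
      this[of "fps_const (theta_sgn \<epsilon> (int j - int N))"]
    show ?thesis unfolding T_def by (simp add: mult_ac eq_upto_def)
  qed
  have "eq_upto m (qprod (- \<epsilon>) c ?s * qprod (- \<epsilon>) d ?s * Q) (qprod_fin (- \<epsilon>) c ?s N * qprod_fin (- \<epsilon>) d ?s N * Q)"
    using assms by (intro eq_upto_mult qprod_eq_upto) (auto simp: N_def)
  also have "\<dots> = (\<Sum>j\<le>2 * N. gbinom t (2 * N) j * T (int j - int N) * Q)"
    unfolding fin by (simp add: sum_distrib_right)
  also have "eq_upto m \<dots> (\<Sum>j\<le>2 * N. T (int j - int N))"
    by (rule eq_upto_sum) (use lim in auto)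
  also have "eq_upto m \<dots> (theta_series (theta_sgn \<epsilon>) ?e)"
    unfolding eq_upto_def
  proof safe
    fix k assume k: "k < m"
    have "fps_nth (\<Sum>j\<le>2 * N. T (int j - int N)) k =
        (\<Sum>j\<le>2 * N. if ?e (int j - int N) = int k then theta_sgn \<epsilon> (int j - int N) else 0)"
      unfolding fps_sum_nth T_def using e_nonneg
      by (intro sum.cong) (auto simp: fps_X_power_mult_right_nth)
    also have "\<dots> = (\<Sum>j | j \<le> 2 * N \<and> ?e (int j - int N) = int k. theta_sgn \<epsilon> (int j - int N))"
      by (subst sum.inter_filter[symmetric]) auto
    also have "\<dots> = (\<Sum>n | ?e n = int k. theta_sgn \<epsilon> n)"
    proof (rule sum.reindex_bij_witness[of _ "\<lambda>n. nat (n + int N)" "\<lambda>j. int j - int N"])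
      fix n assume "n \<in> {n. ?e n = int k}"
      then have "\<bar>n\<bar> \<le> int k" "?e n = int k" using e_ge[of n] by auto
      then show "nat (n + int N) \<in> {j. j \<le> 2 * N \<and> ?e (int j - int N) = int k}"
        "int (nat (n + int N)) - int N = n"
        using k by (auto simp: N_def)
    qed auto
    finally show "fps_nth (\<Sum>j\<le>2 * N. T (int j - int N)) k = fps_nth (theta_series (theta_sgn \<epsilon>) ?e) k"
      by (simp add: theta_series_def)
  qed
  finally show "eq_upto m (theta_series (theta_sgn \<epsilon>) ?e) (qprod (- \<epsilon>) c ?s * qprod (- \<epsilon>) d ?s * qprod 1 ?s ?s)"
    unfolding Q_def by (rule eq_upto_sym)
qed

section \<open>Product formulas for the theta series and identities between them\<close>

lemma theta_expI: "(\<And>n. 2 * e n = int c * (n\<^sup>2 + n) + int d * (n\<^sup>2 - n)) \<Longrightarrow> e = theta_exp c d"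
  using theta_exp_double[of c d] by (auto simp: fun_eq_iff) (metis mult_cancel_left zero_neq_numeral)

abbreviation "euler k \<equiv> qprod 1 k k"

lemma phi_prod: "phi = qprod (- 1) 1 2 ^ 2 * euler 2"
proof -
  have *: "(\<lambda>n. n\<^sup>2) = theta_exp 1 1" by (rule theta_expI) simp
  have **: "(\<lambda>_. 1) = theta_sgn 1" by (simp add: theta_sgn_def[abs_def])
  show ?thesis
    unfolding phi_def * ** by (subst triple_product) (simp_all add: power2_eq_square numeral_2_eq_2)
qed

lemma phi_neg_prod: "phi_neg = qprod 1 1 2 ^ 2 * euler 2"
proof -
  have *: "(\<lambda>n. n\<^sup>2) = theta_exp 1 1" by (rule theta_expI) simp
  have **: "alt_sgn = theta_sgn (- 1)" by (simp add: theta_sgn_def[abs_def] alt_sgn_def[abs_def])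
  show ?thesis
    unfolding phi_neg_def * ** by (subst triple_product) (simp_all add: power2_eq_square numeral_2_eq_2)
qed

lemma psi_prod: "psi = qprod (- 1) 1 2 * euler 4"
proof -
  have *: "(\<lambda>n. 2 * n\<^sup>2 - n) = theta_exp 1 3" by (rule theta_expI) (simp add: algebra_simps)
  have **: "(\<lambda>_. 1) = theta_sgn 1" by (simp add: theta_sgn_def[abs_def])
  show ?thesis
    unfolding psi_def * ** using qprod_split2[of 2 "- 1" 1]
    by (subst triple_product) (simp_all add: eval_nat_numeral)
qed

lemma pent_prod: "pent = qprod (- 1) 2 3 * qprod (- 1) 1 3 * euler 3"
proof -
  have "2 * (n * (3 * n + 1) div 2) = n * (3 * n + 1)" for n :: int by simp
  then have *: "(\<lambda>n. n * (3 * n + 1) div 2) = theta_exp 2 1"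
    by (intro theta_expI) (simp add: algebra_simps power2_eq_square)
  have **: "(\<lambda>_. 1) = theta_sgn 1" by (simp add: theta_sgn_def[abs_def])
  show ?thesis
    unfolding pent_def * ** by (subst triple_product) simp_all
qed

lemma omega_prod: "omega = qprod 1 1 6 * qprod 1 5 6 * euler 6"
proof -
  have *: "(\<lambda>n. 3 * n\<^sup>2 - 2 * n) = theta_exp 1 5" by (rule theta_expI) (simp add: algebra_simps)
  have **: "alt_sgn = theta_sgn (- 1)" by (simp add: theta_sgn_def[abs_def] alt_sgn_def[abs_def])
  show ?thesis
    unfolding omega_def * ** by (subst triple_product) simp_all
qed

lemma dilate_const [simp]: "dilate k (fps_const c) = fps_const c"
  by (simp add: dilate_def)

lemma dilate_prod: "k > 0 \<Longrightarrow> dilate k (\<Prod>i\<in>A. F i) = (\<Prod>i\<in>A. dilate k (F i))"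
  by (induction A rule: infinite_finite_induct) (simp_all add: dilate_mult)

lemma eq_upto_dilate:
  assumes "eq_upto m F G" "k > 0"
  shows "eq_upto m (dilate k F) (dilate k G)"
  unfolding eq_upto_def
proof safe
  fix n assume "n < m"
  then have "n div k < m" using div_le_dividend le_less_trans by blast
  then show "fps_nth (dilate k F) n = fps_nth (dilate k G) n"
    using assms by (simp add: dilate_nth eq_upto_def)
qed

lemma dilate_qprod:
  assumes "k > 0" "b > 0"
  shows "dilate k (qprod c a b) = qprod c (k * a) (k * b)"
proof (rule eq_upto_imp_eq)
  fix m :: nat
  have "eq_upto m (qprod c a b) (qprod_fin c a b m)" using assms by (intro qprod_eq_upto) auto
  then have "eq_upto m (dilate k (qprod c a b)) (dilate k (qprod_fin c a b m))"
    using assms by (intro eq_upto_dilate)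
  also have "dilate k (qprod_fin c a b m) = qprod_fin c (k * a) (k * b) m"
    using assms by (simp add: qprod_fin_def dilate_prod dilate_simps algebra_simps flip: power_mult)
  also have "eq_upto m \<dots> (qprod c (k * a) (k * b))"
    using assms by (intro eq_upto_sym[OF qprod_eq_upto]) auto
  finally show "eq_upto m (dilate k (qprod c a b)) (qprod c (k * a) (k * b))" .
qed

lemma dilate_inject: "k > 0 \<Longrightarrow> dilate k F = dilate k G \<longleftrightarrow> F = G"
  by (metis section_fps_dilate)

lemma E_split: "qprod 1 1 2 * euler 2 = euler 1" "qprod 1 2 4 * euler 4 = euler 2" "qprod 1 3 6 * euler 6 = euler 3"
proof -
  show "qprod 1 1 2 * euler 2 = euler 1" using qprod_split2[of 1 1 1] by (simp add: numeral_2_eq_2)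
  show "qprod 1 2 4 * euler 4 = euler 2" "qprod 1 3 6 * euler 6 = euler 3"
    using qprod_split2[of 2 1 2] qprod_split2[of 3 1 3] by simp_all
qed

lemma qprod_odd_E: "qprod (- 1) 1 2 * euler 1 * euler 4 = euler 2 ^ 2"
proof -
  have "qprod (- 1) 1 2 * euler 1 * euler 4 = (qprod 1 1 2 * qprod (- 1) 1 2) * euler 4 * euler 2"
    by (simp only: E_split(1)[symmetric] mult_ac)
  also have "qprod 1 1 2 * qprod (- 1) 1 2 = qprod 1 2 4"
    using qprod_square[of 2 1] by simp
  finally show ?thesis using E_split by (simp add: power2_eq_square)
qed

text \<open>Here and below each theta series is written as an eta quotient with cleared
  denominators. An identity between theta products then becomes an equality of monomials in the
  \<open>euler k\<close>, up to cancelling a nonzero factor.\<close>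

lemma phi_neg_E: "phi_neg * euler 2 = euler 1 ^ 2"
  unfolding phi_neg_prod E_split(1)[symmetric] by (simp add: power2_eq_square)

lemma phi_E: "phi * euler 1 ^ 2 * euler 4 ^ 2 = euler 2 ^ 5"
proof -
  have "phi * euler 1 ^ 2 * euler 4 ^ 2 = (qprod (- 1) 1 2 * euler 1 * euler 4) ^ 2 * euler 2"
    unfolding phi_prod by (simp add: power2_eq_square)
  also have "\<dots> = euler 2 ^ 5" unfolding qprod_odd_E by Groebner_Basis.algebra
  finally show ?thesis .
qed

lemma psi_E: "psi * euler 1 = euler 2 ^ 2"
  unfolding psi_prod qprod_odd_E[symmetric] by (simp add: mult_ac)

lemma pent_E: "pent * euler 1 * euler 6 = euler 2 * euler 3 ^ 2"
proof -
  have 1: "qprod (- 1) 1 1 * euler 1 = euler 2" "qprod (- 1) 3 3 * euler 3 = euler 6"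
    using qprod_square[of 1 1] qprod_square[of 3 3] by (simp_all add: mult.commute numeral_2_eq_2)
  have 2: "qprod (- 1) 1 3 * qprod (- 1) 2 3 * qprod (- 1) 3 3 = qprod (- 1) 1 1"
    using qprod_split3[of 1 "- 1" 1] by (simp add: eval_nat_numeral)
  have "pent * euler 1 * euler 6 = (qprod (- 1) 1 3 * qprod (- 1) 2 3 * qprod (- 1) 3 3) * euler 1 * euler 3 ^ 2"
    unfolding pent_prod 1(2)[symmetric] by (simp add: power2_eq_square mult_ac)
  then show ?thesis unfolding 2 1 .
qed

lemma omega_E: "omega * euler 2 * euler 3 = euler 1 * euler 6 ^ 2"
proof -
  have 2: "qprod 1 1 6 * qprod 1 3 6 * qprod 1 5 6 = qprod 1 1 2"
    using qprod_split3[of 2 1 1] by (simp add: eval_nat_numeral)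
  have "omega * euler 2 * euler 3 = (qprod 1 1 6 * qprod 1 3 6 * qprod 1 5 6) * euler 2 * euler 6 ^ 2"
    unfolding omega_prod E_split(3)[symmetric] by (simp add: power2_eq_square mult_ac)
  then show ?thesis unfolding 2 E_split .
qed

lemma dilate_phi_neg_E: "k > 0 \<Longrightarrow> dilate k phi_neg * euler (2 * k) = euler k ^ 2"
  using arg_cong[OF phi_neg_E, of "dilate k"] by (simp add: dilate_simps dilate_qprod mult.commute)

lemma dilate_psi_E: "k > 0 \<Longrightarrow> dilate k psi * euler k = euler (2 * k) ^ 2"
  using arg_cong[OF psi_E, of "dilate k"] by (simp add: dilate_simps dilate_qprod mult.commute)

lemma fps_mult_right_cancelI:
  assumes "F * c = G * c" "c \<noteq> (0 :: int fps)"
  shows "F = G"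
  using assms by simp

text \<open>This relation makes the two 3-dissections compatible: it is what gives
  \<open>psi\<close> the components \<open>a\<close> and \<open>x\<close> of \<open>phi_neg\<close>,
  see \<open>psi_b\<close>.\<close>

lemma omega_pent: "omega * pent = dilate 3 phi_neg * dilate 3 psi"
proof (rule fps_mult_right_cancelI)
  have "omega * pent * (euler 1 * euler 2 * euler 3 * euler 6) = (omega * euler 2 * euler 3) * (pent * euler 1 * euler 6)" by Groebner_Basis.algebra
  also have "\<dots> = (euler 3 ^ 2) * (euler 6 ^ 2) * (euler 1 * euler 2)" unfolding omega_E pent_E by Groebner_Basis.algebra
  also have "\<dots> = (dilate 3 phi_neg * euler 6) * (dilate 3 psi * euler 3) * (euler 1 * euler 2)"
    using dilate_phi_neg_E[of 3] dilate_psi_E[of 3] by simp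
  finally show "omega * pent * (euler 1 * euler 2 * euler 3 * euler 6) = dilate 3 phi_neg * dilate 3 psi * (euler 1 * euler 2 * euler 3 * euler 6)"
    by Groebner_Basis.algebra
qed simp

text \<open>Together with \<open>omega_pent\<close> it eliminates \<open>pent\<close> and
  \<open>omega\<close> from the congruences once the trisections are done.\<close>

lemma psi_phi_neg_pent: "psi * dilate 3 phi_neg ^ 3 = phi_neg * pent ^ 3"
proof (rule fps_mult_right_cancelI)
  let ?c = "euler 1 ^ 3 * euler 2 * euler 6 ^ 3"
  have "psi * dilate 3 phi_neg ^ 3 * ?c = (psi * euler 1) * (dilate 3 phi_neg * euler 6) ^ 3 * euler 1 ^ 2 * euler 2" by Groebner_Basis.algebra
  also have "\<dots> = (euler 2 ^ 2) * (euler 3 ^ 2) ^ 3 * euler 1 ^ 2 * euler 2"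
    unfolding psi_E using dilate_phi_neg_E[of 3] by simp
  also have "\<dots> = (euler 1 ^ 2) * (euler 2 * euler 3 ^ 2) ^ 3" by Groebner_Basis.algebra
  also have "\<dots> = (phi_neg * euler 2) * (pent * euler 1 * euler 6) ^ 3" unfolding pent_E phi_neg_E ..
  also have "\<dots> = phi_neg * pent ^ 3 * ?c" by Groebner_Basis.algebra
  finally show "psi * dilate 3 phi_neg ^ 3 * ?c = phi_neg * pent ^ 3 * ?c" .
qed simp

lemma phi_phi_neg: "phi * phi_neg = dilate 2 phi_neg ^ 2"
proof (rule fps_mult_right_cancelI)
  let ?c = "euler 1 ^ 2 * euler 4 ^ 2 * euler 2"
  have "phi * phi_neg * ?c = (phi * euler 1 ^ 2 * euler 4 ^ 2) * (phi_neg * euler 2)" by Groebner_Basis.algebra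
  also have "\<dots> = (euler 2 ^ 2) ^ 2 * euler 1 ^ 2 * euler 2" unfolding phi_E phi_neg_E by Groebner_Basis.algebra
  also have "\<dots> = (dilate 2 phi_neg * euler 4) ^ 2 * euler 1 ^ 2 * euler 2" using dilate_phi_neg_E[of 2] by simp
  also have "\<dots> = dilate 2 phi_neg ^ 2 * ?c" by Groebner_Basis.algebra
  finally show "phi * phi_neg * ?c = dilate 2 phi_neg ^ 2 * ?c" .
qed simp

lemma psi_square: "psi ^ 2 = phi * dilate 2 psi"
proof (rule fps_mult_right_cancelI)
  let ?c = "euler 1 ^ 2 * euler 4 ^ 2 * euler 2"
  have "psi ^ 2 * ?c = (psi * euler 1) ^ 2 * euler 4 ^ 2 * euler 2" by Groebner_Basis.algebra
  also have "\<dots> = euler 2 ^ 5 * euler 4 ^ 2" unfolding psi_E by Groebner_Basis.algebra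
  also have "\<dots> = (phi * euler 1 ^ 2 * euler 4 ^ 2) * (dilate 2 psi * euler 2)"
    unfolding phi_E using dilate_psi_E[of 2] by simp
  also have "\<dots> = phi * dilate 2 psi * ?c" by Groebner_Basis.algebra
  finally show "psi ^ 2 * ?c = phi * dilate 2 psi * ?c" .
qed simp

text \<open>By the 2-dissections \<open>phi * phi_neg\<close> is a difference of two squares, and it
  equals \<open>dilate 2 phi_neg ^ 2\<close>. This is the claim with \<open>q^2\<close> for
  \<open>q\<close>, and dilation is injective.\<close>

lemma phi_neg_square: "phi_neg ^ 2 = dilate 2 phi ^ 2 - 4 * fps_X * dilate 4 psi ^ 2"
proof -
  have "dilate 2 (phi_neg ^ 2) = phi * phi_neg" by (simp add: phi_phi_neg dilate_simps)
  also have "\<dots> = (dilate 4 phi + 2 * fps_X * dilate 8 psi) * (dilate 4 phi - 2 * fps_X * dilate 8 psi)"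
    using phi_dissect2 phi_neg_dissect2 by simp
  also have "\<dots> = dilate 2 (dilate 2 phi ^ 2 - 4 * fps_X * dilate 4 psi ^ 2)"
    by (simp add: dilate_simps algebra_simps power2_eq_square)
  finally show ?thesis by (simp add: dilate_inject)
qed

lemma phi_square: "phi ^ 2 = dilate 2 phi ^ 2 + 4 * fps_X * dilate 4 psi ^ 2"
proof -
  have ab: "dilate 4 psi ^ 2 = dilate 4 phi * dilate 8 psi"
    using arg_cong[OF psi_square, of "dilate 4"] by (simp add: dilate_simps)
  have "phi ^ 2 = phi_neg ^ 2 + 8 * fps_X * (dilate 4 phi * dilate 8 psi)"
    by (subst phi_dissect2, subst phi_neg_dissect2) Groebner_Basis.algebra
  then show ?thesis unfolding phi_neg_square ab by Groebner_Basis.algebra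
qed

text \<open>Converts the quotient \<open>(-q; q^2) / (q; q^2)\<close>, which iterating the
  functional equation leaves behind in \<open>q^2\<close>, into a quotient of theta series.\<close>

lemma qprod_odd_phi_neg: "qprod (- 1) 1 2 * dilate 2 phi_neg = qprod 1 1 2 * phi"
proof -
  let ?u = "qprod 1 1 2" and ?w = "qprod (- 1) 1 2"
  have uw: "qprod 1 2 4 = ?u * ?w" using qprod_square[of 2 1] by simp
  have "dilate 2 phi_neg = qprod 1 2 4 ^ 2 * euler 4"
    unfolding phi_neg_prod by (simp add: dilate_simps dilate_qprod)
  then have "?w * dilate 2 phi_neg = ?w * ((?u * ?w) ^ 2 * euler 4)" unfolding uw by simp
  also have "\<dots> = ?u * (?w ^ 2 * (?u * ?w * euler 4))" by Groebner_Basis.algebra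
  also have "\<dots> = ?u * phi" unfolding phi_prod E_split(2)[symmetric] uw ..
  finally show ?thesis .
qed

section \<open>The mock theta function\<close>

definition fps_recip :: "int fps \<Rightarrow> int fps" where "fps_recip F = fps_right_inverse F 1"

lemma fps_recip: "fps_nth F 0 = 1 \<Longrightarrow> F * fps_recip F = 1"
  unfolding fps_recip_def by (rule fps_right_inverse) simp

lemma fps_recip_unique:
  assumes "F * G = 1" "fps_nth F 0 = 1"
  shows "fps_recip F = G"
proof -
  have "fps_recip F = fps_recip F * (F * G)" by (simp add: assms)
  also have "\<dots> = (F * fps_recip F) * G" by (simp only: mult_ac)
  finally show ?thesis by (simp add: fps_recip assms)
qed

definition mock_num :: "int fps \<Rightarrow> nat \<Rightarrow> int fps" where
  "mock_num \<gamma> n = (\<Prod>i<n. \<gamma> + fps_X ^ (2 * i + 1))"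

definition mock_den :: "int fps \<Rightarrow> nat \<Rightarrow> int fps" where
  "mock_den \<gamma> n = (\<Prod>i<n. 1 - \<gamma> * fps_X ^ (2 * i + 1))"

text \<open>The summand of \<open>h\<close>; the letter \<open>g\<close> is reserved for
  \<open>fps_X * \<gamma>\<close> from here on. The parameter is itself a series in
  \<open>q\<close>, so that one definition serves at 1, at -1 and at the powers of \<open>q\<close>
  reached by the iteration.\<close>

definition mock_term :: "int fps \<Rightarrow> nat \<Rightarrow> int fps" where
  "mock_term \<gamma> n = fps_X ^ (n\<^sup>2) * (mock_num \<gamma> n * fps_recip (mock_den \<gamma> n))"

definition mock_sum :: "int fps \<Rightarrow> int fps" where
  "mock_sum \<gamma> = Abs_fps (\<lambda>k. \<Sum>n\<le>k. fps_nth (mock_term \<gamma> n) k)"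

lemma mock_den_nth_0 [simp]: "fps_nth (mock_den \<gamma> n) 0 = 1"
  by (induction n) (simp_all add: mock_den_def)

lemma mock_term_eq_upto_0: "m \<le> n \<Longrightarrow> eq_upto m (mock_term \<gamma> n) 0"
  unfolding mock_term_def by (rule eq_upto_X_power) (simp add: power2_eq_square le_trans[OF _ le_square])

lemma mock_sum_eq_upto:
  assumes "m \<le> M"
  shows "eq_upto m (mock_sum \<gamma>) (\<Sum>n<M. mock_term \<gamma> n)"
  unfolding eq_upto_def
proof safe
  fix k assume k: "k < m"
  have "(\<Sum>n\<le>k. fps_nth (mock_term \<gamma> n) k) = (\<Sum>n<M. fps_nth (mock_term \<gamma> n) k)"
  proof (rule sum.mono_neutral_left)
    show "\<forall>i\<in>{..<M} - {..k}. fps_nth (mock_term \<gamma> i) k = 0"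
    proof
      fix i assume "i \<in> {..<M} - {..k}"
      then have "eq_upto (Suc k) (mock_term \<gamma> i) 0" by (intro mock_term_eq_upto_0) auto
      then show "fps_nth (mock_term \<gamma> i) k = 0" by (simp add: eq_upto_def)
    qed
  qed (use k assms in auto)
  then show "fps_nth (mock_sum \<gamma>) k = fps_nth (\<Sum>n<M. mock_term \<gamma> n) k"
    by (simp add: mock_sum_def fps_sum_nth)
qed

text \<open>
  For \<open>n \<ge> 1\<close> this is \<open>- g (1 - g^2) mock_term \<gamma> n / (g + q^(2n))\<close>, with the factor
  \<open>g + q^(2n) = q (\<gamma> + q^(2n-1))\<close> already cancelled.
\<close>

definition mock_cert :: "int fps \<Rightarrow> nat \<Rightarrow> int fps" where
  "mock_cert \<gamma> n = (let g = fps_X * \<gamma> in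
     case n of 0 \<Rightarrow> - g * (1 - g)
     | Suc m \<Rightarrow> - g * (1 - g\<^sup>2) * fps_X ^ (m\<^sup>2 + 2 * m) * (mock_num \<gamma> m * fps_recip (mock_den \<gamma> (Suc m))))"

lemma fps_recip_mock_den_Suc: "fps_recip (mock_den \<gamma> n) = (1 - \<gamma> * fps_X ^ (2 * n + 1)) * fps_recip (mock_den \<gamma> (Suc n))"
proof (rule fps_recip_unique)
  have "mock_den \<gamma> n * ((1 - \<gamma> * fps_X ^ (2 * n + 1)) * fps_recip (mock_den \<gamma> (Suc n))) = mock_den \<gamma> (Suc n) * fps_recip (mock_den \<gamma> (Suc n))"
    by (simp add: mock_den_def mult.assoc)
  then show "mock_den \<gamma> n * ((1 - \<gamma> * fps_X ^ (2 * n + 1)) * fps_recip (mock_den \<gamma> (Suc n))) = 1"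
    by (simp add: fps_recip)
qed simp

lemma mock_den_shift: "(1 - \<gamma> * fps_X) * mock_den (\<gamma> * fps_X\<^sup>2) n = mock_den \<gamma> (Suc n)"
  unfolding mock_den_def by (subst prod.lessThan_Suc_shift) (simp add: power2_eq_square mult.assoc)

lemma fps_recip_mock_den_shift: "fps_recip (mock_den (\<gamma> * fps_X\<^sup>2) n) = (1 - \<gamma> * fps_X) * fps_recip (mock_den \<gamma> (Suc n))"
proof (rule fps_recip_unique)
  have "mock_den (\<gamma> * fps_X\<^sup>2) n * ((1 - \<gamma> * fps_X) * fps_recip (mock_den \<gamma> (Suc n))) =
      ((1 - \<gamma> * fps_X) * mock_den (\<gamma> * fps_X\<^sup>2) n) * fps_recip (mock_den \<gamma> (Suc n))" by (simp only: mult_ac)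
  then show "mock_den (\<gamma> * fps_X\<^sup>2) n * ((1 - \<gamma> * fps_X) * fps_recip (mock_den \<gamma> (Suc n))) = 1"
    unfolding mock_den_shift by (simp add: fps_recip)
qed simp

text \<open>Each factor after the first is \<open>q^2\<close> times a factor of
  \<open>mock_num \<gamma> m\<close>. Hence the shifted term is a rational multiple of the unshifted
  one, as a telescoping certificate requires.\<close>

lemma mock_num_shift: "mock_num (\<gamma> * fps_X\<^sup>2) (Suc m) = fps_X ^ (2 * m + 1) * (1 + fps_X * \<gamma>) * mock_num \<gamma> m"
proof -
  have "(\<Prod>i<m. \<gamma> * fps_X\<^sup>2 + fps_X ^ (2 * Suc i + 1)) = (\<Prod>i<m. fps_X\<^sup>2 * (\<gamma> + fps_X ^ (2 * i + 1)))"
    by (simp add: power2_eq_square algebra_simps)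
  also have "\<dots> = fps_X ^ (2 * m) * mock_num \<gamma> m"
    by (simp add: prod.distrib mock_num_def power_mult)
  finally show ?thesis
    unfolding mock_num_def by (subst prod.lessThan_Suc_shift) (simp add: power2_eq_square algebra_simps)
qed

text \<open>For \<open>n > 0\<close> all four quantities are multiples of the common factor
  \<open>?K\<close>; what remains is a polynomial identity in \<open>\<gamma>\<close>,
  \<open>fps_X\<close> and \<open>v\<close>.\<close>

lemma mock_term_telescope:
  fixes \<gamma> :: "int fps"
  defines "g \<equiv> fps_X * \<gamma>"
  shows "(1 - g\<^sup>2) * mock_term \<gamma> n - (1 + g\<^sup>2) * mock_term (\<gamma> * fps_X\<^sup>2) n = mock_cert \<gamma> (Suc n) - mock_cert \<gamma> n"
proof (cases n)
  \<comment> \<open>The separate value of the certificate at 0 is the general formula with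
    \<open>(1 - g^2) / (g + 1)\<close> simplified to \<open>1 - g\<close>.\<close>
  case 0
  have "(1 - g) * fps_recip (mock_den \<gamma> 1) = 1"
    using fps_recip[of "mock_den \<gamma> 1"] by (simp add: mock_den_def g_def mult.commute)
  then have "(1 - g\<^sup>2) * fps_recip (mock_den \<gamma> 1) = 1 + g" by Groebner_Basis.algebra
  then have "mock_cert \<gamma> (Suc 0) = - g * (1 + g)"
    by (simp add: mock_cert_def Let_def mock_num_def mult.assoc flip: g_def)
  moreover have "mock_cert \<gamma> 0 = - g * (1 - g)"
    by (simp add: mock_cert_def Let_def flip: g_def)
  moreover have "mock_term \<gamma> 0 = 1" "mock_term (\<gamma> * fps_X\<^sup>2) 0 = 1"
    using fps_recip[of 1] by (simp_all add: mock_term_def mock_num_def mock_den_def)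
  moreover have "(1 - g\<^sup>2) * 1 - (1 + g\<^sup>2) * 1 = - g * (1 + g) - - g * (1 - g)"
    by Groebner_Basis.algebra
  ultimately show ?thesis by (simp only: 0)
next
  case (Suc m)
  let ?I = "fps_recip (mock_den \<gamma> (Suc (Suc m)))"
  let ?K = "mock_num \<gamma> m * ?I * fps_X ^ (m\<^sup>2 + 2 * m)"
  define v where "v = (fps_X ^ (2 * m + 1) :: int fps)"
  have v3: "fps_X ^ (2 * Suc m + 1) = fps_X\<^sup>2 * v" by (simp add: v_def power2_eq_square)
  have e1: "fps_X ^ (n\<^sup>2) = fps_X * (fps_X ^ (m\<^sup>2 + 2 * m) :: int fps)"
    by (simp add: Suc power2_eq_square algebra_simps)
  have e2: "fps_X ^ ((Suc m)\<^sup>2 + 2 * Suc m) = fps_X\<^sup>2 * v * (fps_X ^ (m\<^sup>2 + 2 * m) :: int fps)"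
    by (simp add: v_def power2_eq_square algebra_simps flip: power_add)
  have I: "fps_recip (mock_den \<gamma> (Suc m)) = (1 - \<gamma> * (fps_X\<^sup>2 * v)) * ?I"
    using fps_recip_mock_den_Suc[of \<gamma> "Suc m"] unfolding v3 .
  have NS: "mock_num \<gamma> (Suc m) = mock_num \<gamma> m * (\<gamma> + v)" by (simp add: mock_num_def v_def)
  have t1: "mock_term \<gamma> n = ?K * fps_X * (\<gamma> + v) * (1 - \<gamma> * (fps_X\<^sup>2 * v))"
    unfolding mock_term_def e1 unfolding Suc NS I by Groebner_Basis.algebra
  have t2: "mock_term (\<gamma> * fps_X\<^sup>2) n = ?K * fps_X * v * (1 + fps_X * \<gamma>) * (1 - \<gamma> * fps_X)"
    unfolding mock_term_def e1 unfolding Suc mock_num_shift fps_recip_mock_den_shift v_def[symmetric] by Groebner_Basis.algebra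
  have r1: "mock_cert \<gamma> (Suc n) = - g * (1 - g\<^sup>2) * (fps_X\<^sup>2 * v) * (\<gamma> + v) * ?K"
    unfolding Suc mock_cert_def Let_def nat.case g_def[symmetric] e2 NS by Groebner_Basis.algebra
  have r2: "mock_cert \<gamma> n = - g * (1 - g\<^sup>2) * (1 - \<gamma> * (fps_X\<^sup>2 * v)) * ?K"
    unfolding Suc mock_cert_def Let_def nat.case g_def[symmetric] I by Groebner_Basis.algebra
  show ?thesis unfolding t1 t2 r1 r2 unfolding g_def by Groebner_Basis.algebra
qed

text \<open>Summation of the telescoping relation. The upper boundary term is divisible by
  \<open>q^(m^2 + 2 m)\<close> and disappears in the limit, the lower one is the right-hand
  side.\<close>

lemma mock_sum_functional:
  fixes \<gamma> :: "int fps"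
  defines "g \<equiv> fps_X * \<gamma>"
  shows "(1 - g\<^sup>2) * mock_sum \<gamma> - (1 + g\<^sup>2) * mock_sum (\<gamma> * fps_X\<^sup>2) = g * (1 - g)"
proof (rule eq_upto_imp_eq)
  fix m :: nat
  have "eq_upto m ((1 - g\<^sup>2) * mock_sum \<gamma> - (1 + g\<^sup>2) * mock_sum (\<gamma> * fps_X\<^sup>2))
      ((1 - g\<^sup>2) * (\<Sum>n<Suc m. mock_term \<gamma> n) - (1 + g\<^sup>2) * (\<Sum>n<Suc m. mock_term (\<gamma> * fps_X\<^sup>2) n))"
    by (intro eq_upto_diff eq_upto_mult mock_sum_eq_upto eq_upto_refl) auto
  also have "\<dots> = (\<Sum>n<Suc m. mock_cert \<gamma> (Suc n) - mock_cert \<gamma> n)"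
    unfolding mock_term_telescope[symmetric] g_def by (simp only: sum_subtractf sum_distrib_left)
  also have "\<dots> = mock_cert \<gamma> (Suc m) - mock_cert \<gamma> 0"
    by (rule sum_lessThan_telescope)
  also have "eq_upto m \<dots> (0 - mock_cert \<gamma> 0)"
  proof (rule eq_upto_diff)
    have "eq_upto m (fps_X ^ (m\<^sup>2 + 2 * m) * (- g * (1 - g\<^sup>2) * (mock_num \<gamma> m * fps_recip (mock_den \<gamma> (Suc m))))) 0"
      by (rule eq_upto_X_power) simp
    then show "eq_upto m (mock_cert \<gamma> (Suc m)) 0"
      by (simp add: mock_cert_def Let_def mult_ac flip: g_def)
  qed simp
  also have "0 - mock_cert \<gamma> 0 = g * (1 - g)" by (simp add: mock_cert_def Let_def flip: g_def)
  finally show "eq_upto m ((1 - g\<^sup>2) * mock_sum \<gamma> - (1 + g\<^sup>2) * mock_sum (\<gamma> * fps_X\<^sup>2)) (g * (1 - g))" .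
qed

text \<open>Chosen to make the functional equation homogeneous: symmetrising reduces the
  inhomogeneous term \<open>g (1 - g)\<close> to \<open>-2 g^2\<close>, and this is exactly what the
  constant 1 contributes, as \<open>(1 - g^2) - (1 + g^2) = -2 g^2\<close>.\<close>

definition mock_even :: "int fps \<Rightarrow> int fps" where
  "mock_even \<gamma> = mock_sum \<gamma> + mock_sum (- \<gamma>) - 1"

lemma mock_even_functional: "(1 - (fps_X * \<gamma>)\<^sup>2) * mock_even \<gamma> = (1 + (fps_X * \<gamma>)\<^sup>2) * mock_even (\<gamma> * fps_X\<^sup>2)"
proof -
  let ?g = "fps_X * \<gamma>"
  have "(1 - ?g\<^sup>2) * mock_sum (- \<gamma>) - (1 + ?g\<^sup>2) * mock_sum (- (\<gamma> * fps_X\<^sup>2)) = - ?g * (1 + ?g)"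
    using mock_sum_functional[of "- \<gamma>"] by simp
  moreover have "(1 - ?g\<^sup>2) * mock_even \<gamma> - (1 + ?g\<^sup>2) * mock_even (\<gamma> * fps_X\<^sup>2) =
      ((1 - ?g\<^sup>2) * mock_sum \<gamma> - (1 + ?g\<^sup>2) * mock_sum (\<gamma> * fps_X\<^sup>2)) +
      ((1 - ?g\<^sup>2) * mock_sum (- \<gamma>) - (1 + ?g\<^sup>2) * mock_sum (- (\<gamma> * fps_X\<^sup>2))) + 2 * ?g\<^sup>2"
    unfolding mock_even_def by (simp add: algebra_simps)
  ultimately have "(1 - ?g\<^sup>2) * mock_even \<gamma> - (1 + ?g\<^sup>2) * mock_even (\<gamma> * fps_X\<^sup>2) =
      ?g * (1 - ?g) + - ?g * (1 + ?g) + 2 * ?g\<^sup>2"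
    by (simp only: mock_sum_functional)
  also have "\<dots> = 0" by Groebner_Basis.algebra
  finally show ?thesis by simp
qed

text \<open>At \<open>\<gamma> = q^(2 m)\<close> one has
  \<open>(q \<gamma>)^2 = q^(4 m + 2)\<close>, so each step adds one factor to either
  product.\<close>

lemma mock_even_iterate: "mock_even 1 * qprod_fin 1 2 4 m = qprod_fin (- 1) 2 4 m * mock_even (fps_X ^ (2 * m))"
proof (induction m)
  case (Suc m)
  have e: "(fps_X * fps_X ^ (2 * m))\<^sup>2 = (fps_X ^ (2 + 4 * m) :: int fps)"
    by (simp add: power2_eq_square flip: power_add)
  have e': "fps_X ^ (2 * m) * fps_X\<^sup>2 = (fps_X ^ (2 * Suc m) :: int fps)"
    by (simp add: power2_eq_square)
  have "mock_even 1 * qprod_fin 1 2 4 (Suc m) = (mock_even 1 * qprod_fin 1 2 4 m) * (1 - fps_X ^ (2 + 4 * m))"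
    by (simp add: qprod_fin_def mult.assoc)
  also have "\<dots> = qprod_fin (- 1) 2 4 m * ((1 - fps_X ^ (2 + 4 * m)) * mock_even (fps_X ^ (2 * m)))"
    unfolding Suc by (simp add: mult_ac)
  also have "(1 - fps_X ^ (2 + 4 * m)) * mock_even (fps_X ^ (2 * m)) = (1 + fps_X ^ (2 + 4 * m)) * mock_even (fps_X ^ (2 * Suc m))"
    using mock_even_functional[of "fps_X ^ (2 * m)"] unfolding e e' .
  also have "qprod_fin (- 1) 2 4 m * ((1 + fps_X ^ (2 + 4 * m)) * mock_even (fps_X ^ (2 * Suc m))) =
      qprod_fin (- 1) 2 4 (Suc m) * mock_even (fps_X ^ (2 * Suc m))"
    by (simp add: qprod_fin_def mult.assoc)
  finally show ?case .
qed (simp add: qprod_fin_def)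

lemma eq_upto_fps_recip:
  assumes "eq_upto m F G" "fps_nth F 0 = 1" "fps_nth G 0 = 1"
  shows "eq_upto m (fps_recip F) (fps_recip G)"
proof -
  have "eq_upto m (fps_recip F * F * fps_recip G) (fps_recip F * G * fps_recip G)"
    using assms(1) by (intro eq_upto_mult) auto
  then have "eq_upto m (fps_recip G * (F * fps_recip F)) (fps_recip F * (G * fps_recip G))" by (simp only: mult_ac)
  then show ?thesis using assms by (simp add: fps_recip eq_upto_sym)
qed

lemma mock_term_eq_upto:
  assumes "eq_upto m \<gamma> 0"
  shows "eq_upto m (mock_term \<gamma> n) (fps_X ^ (2 * n\<^sup>2))"
proof -
  have "eq_upto m (mock_num \<gamma> n) (\<Prod>i<n. 0 + fps_X ^ (2 * i + 1))"
    unfolding mock_num_def using assms by (intro eq_upto_prod eq_upto_add) auto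
  also have "(\<Prod>i<n. 0 + fps_X ^ (2 * i + 1)) = (fps_X ^ (n\<^sup>2) :: int fps)"
    by (induction n) (simp_all add: power2_eq_square algebra_simps flip: power_add)
  finally have N: "eq_upto m (mock_num \<gamma> n) (fps_X ^ (n\<^sup>2))" .
  have "eq_upto m (mock_den \<gamma> n) (\<Prod>i<n. 1 - 0 * fps_X ^ (2 * i + 1))"
    unfolding mock_den_def using assms by (intro eq_upto_prod eq_upto_diff eq_upto_mult) auto
  then have "eq_upto m (fps_recip (mock_den \<gamma> n)) (fps_recip 1)" by (intro eq_upto_fps_recip) auto
  moreover have "fps_recip 1 = 1" by (rule fps_recip_unique) auto
  ultimately have "eq_upto m (mock_term \<gamma> n) (fps_X ^ (n\<^sup>2) * (fps_X ^ (n\<^sup>2) * 1))"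
    unfolding mock_term_def using N by (intro eq_upto_mult) auto
  then show ?thesis by (simp add: mult_2 power_add)
qed

text \<open>At \<open>\<gamma> = 0\<close> the summand degenerates to \<open>q^(2 n^2)\<close>. Two
  copies of the sum over \<open>n \<ge> 0\<close> cover all integers, with 0 counted twice; the
  \<open>- 1\<close> in \<open>mock_even\<close> corrects this.\<close>

lemma mock_even_limit:
  assumes "eq_upto m \<gamma> 0"
  shows "eq_upto m (mock_even \<gamma>) (dilate 2 phi)"
proof -
  have h: "eq_upto m (mock_sum \<gamma>) (\<Sum>n<Suc m. fps_X ^ (2 * n\<^sup>2))" if "eq_upto m \<gamma> 0" for \<gamma>
  proof -
    have "eq_upto m (mock_sum \<gamma>) (\<Sum>n<Suc m. mock_term \<gamma> n)" by (rule mock_sum_eq_upto) simp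
    also have "eq_upto m \<dots> (\<Sum>n<Suc m. fps_X ^ (2 * n\<^sup>2))"
      by (intro eq_upto_sum mock_term_eq_upto that)
    finally show ?thesis .
  qed
  have "eq_upto m (mock_even \<gamma>) ((\<Sum>n<Suc m. fps_X ^ (2 * n\<^sup>2)) + (\<Sum>n<Suc m. fps_X ^ (2 * n\<^sup>2)) - 1)"
    unfolding mock_even_def using assms by (intro eq_upto_diff eq_upto_add h) (auto simp: eq_upto_def)
  also have "eq_upto m \<dots> (dilate 2 phi)"
    unfolding eq_upto_def
  proof safe
    fix k assume k: "k < m"
    define A where "A = {n. n < Suc m \<and> 2 * n\<^sup>2 = k}"
    have fin: "finite A" by (simp add: A_def)
    have "fps_nth (\<Sum>n<Suc m. fps_X ^ (2 * n\<^sup>2) :: int fps) k = (\<Sum>n<Suc m. if 2 * n\<^sup>2 = k then 1 else 0)"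
      unfolding fps_sum_nth by (intro sum.cong) auto
    also have "\<dots> = int (card A)"
      by (subst sum.inter_filter[symmetric]) (auto simp: A_def)
    finally have s: "fps_nth (\<Sum>n<Suc m. fps_X ^ (2 * n\<^sup>2) :: int fps) k = int (card A)" .
    have "fps_nth (dilate 2 phi) k = int (card {n::int. 2 * n\<^sup>2 = int k})"
    proof -
      have "phi = theta_series (\<lambda>_. 1) (\<lambda>n. n\<^sup>2)" by (rule phi_def)
      then have "dilate 2 phi = theta_series (\<lambda>_. 1) (\<lambda>n. int 2 * n\<^sup>2)" by (simp only: theta_series_dilate zero_less_numeral)
      then show ?thesis by (simp add: theta_series_def)
    qed
    moreover have "{n::int. 2 * n\<^sup>2 = int k} = int ` A \<union> (\<lambda>n. - int n) ` A"
    proof (intro equalityI subsetI)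
      fix n :: int assume "n \<in> {n. 2 * n\<^sup>2 = int k}"
      then have n: "2 * n\<^sup>2 = int k" by simp
      have "int (2 * (nat \<bar>n\<bar>)\<^sup>2) = int k" using n by simp
      then have "2 * (nat \<bar>n\<bar>)\<^sup>2 = k" by (simp only: of_nat_eq_iff)
      moreover have "nat \<bar>n\<bar> < Suc m" using n k abs_le_square[of n] by linarith
      ultimately have A: "nat \<bar>n\<bar> \<in> A" by (simp add: A_def)
      show "n \<in> int ` A \<union> (\<lambda>n. - int n) ` A"
      proof (cases "n \<ge> 0")
        case True
        then have "n = int (nat \<bar>n\<bar>)" by simp
        with A show ?thesis by blast
      next
        case False
        then have "n = - int (nat \<bar>n\<bar>)" by simp
        with A show ?thesis by blast
      qed
    next
      fix n :: int assume "n \<in> int ` A \<union> (\<lambda>n. - int n) ` A"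
      then show "n \<in> {n. 2 * n\<^sup>2 = int k}" by (auto simp: A_def simp flip: of_nat_power)
    qed
    moreover have "card (int ` A \<union> (\<lambda>n. - int n) ` A) + card (int ` A \<inter> (\<lambda>n. - int n) ` A) =
        card A + card A"
      using fin by (subst card_Un_Int[symmetric]) (auto simp: card_image inj_on_def)
    moreover have "int ` A \<inter> (\<lambda>n. - int n) ` A = (if k = 0 then {0} else {})"
      by (auto simp: A_def image_iff)
    then have "card (int ` A \<inter> (\<lambda>n. - int n) ` A) = (if k = 0 then 1 else 0)" by simp
    ultimately have "fps_nth (dilate 2 phi) k = int (card {n::int. 2 * n\<^sup>2 = int k})"
      "card {n::int. 2 * n\<^sup>2 = int k} + (if k = 0 then 1 else 0) = card A + card A"
      by simp_all
    then have "fps_nth (dilate 2 phi) k = 2 * int (card A) - (if k = 0 then 1 else 0)"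
      by (cases "k = 0") simp_all
    then show "fps_nth ((\<Sum>n<Suc m. fps_X ^ (2 * n\<^sup>2)) + (\<Sum>n<Suc m. fps_X ^ (2 * n\<^sup>2)) - 1) k =
        fps_nth (dilate 2 phi) k"
      unfolding fps_add_nth fps_sub_nth s by simp
  qed
  finally show ?thesis .
qed

lemma mock_even_1: "mock_even 1 * qprod 1 2 4 = qprod (- 1) 2 4 * dilate 2 phi"
proof (rule eq_upto_imp_eq)
  fix m :: nat
  have "eq_upto m (fps_X ^ (2 * m) * 1 :: int fps) 0" by (rule eq_upto_X_power) simp
  then have "eq_upto m (fps_X ^ (2 * m)) 0" by simp
  note lim = mock_even_limit[OF this]
  have "eq_upto m (mock_even 1 * qprod 1 2 4) (mock_even 1 * qprod_fin 1 2 4 m)"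
    by (intro eq_upto_mult qprod_eq_upto) auto
  also have "\<dots> = qprod_fin (- 1) 2 4 m * mock_even (fps_X ^ (2 * m))" by (rule mock_even_iterate)
  also have "eq_upto m \<dots> (qprod (- 1) 2 4 * dilate 2 phi)"
    by (intro eq_upto_mult lim eq_upto_sym[OF qprod_eq_upto]) auto
  finally show "eq_upto m (mock_even 1 * qprod 1 2 4) (qprod (- 1) 2 4 * dilate 2 phi)" .
qed

lemma mock_even_1_phi_neg: "mock_even 1 * dilate 4 phi_neg = dilate 2 phi ^ 2"
proof (rule fps_mult_right_cancelI)
  have "qprod (- 1) 2 4 * dilate 4 phi_neg = qprod 1 2 4 * dilate 2 phi"
    using arg_cong[OF qprod_odd_phi_neg, of "dilate 2"] by (simp add: dilate_simps dilate_qprod)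
  then have "(mock_even 1 * qprod 1 2 4) * dilate 4 phi_neg = (qprod 1 2 4 * dilate 2 phi) * dilate 2 phi"
    unfolding mock_even_1 by (simp add: mult_ac)
  then show "mock_even 1 * dilate 4 phi_neg * qprod 1 2 4 = dilate 2 phi ^ 2 * qprod 1 2 4"
    by (simp add: power2_eq_square mult_ac)
qed simp

text \<open>In \<open>phi_square\<close> with \<open>q^2\<close> for \<open>q\<close>, the second
  summand has exponents 2 modulo 4 only, and the denominator \<open>dilate 4 phi_neg\<close> is a
  scalar for this extraction.\<close>

lemma mock_even_1_section4: "section_fps 4 0 (mock_even 1) * phi_neg = phi ^ 2"
proof -
  have "dilate 2 phi ^ 2 = dilate 4 (phi ^ 2) + fps_X ^ 2 * dilate 4 (4 * dilate 2 psi ^ 2)"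
    using arg_cong[OF phi_square, of "dilate 2"] by (simp add: dilate_simps mult_ac)
  then have "section_fps 4 0 (dilate 2 phi ^ 2) = phi ^ 2"
    by (simp only: section_fps_add section_fps_dilate section_fps_X_dilate zero_less_numeral) simp
  then show ?thesis
    using section_fps_dilate_mult[of 0 4 phi_neg "mock_even 1"] mock_even_1_phi_neg by (simp add: mult.commute)
qed

section \<open>The substitution of \<open>-q\<close> for \<open>q\<close> and the even
  coefficients\<close>

definition fps_alt :: "int fps \<Rightarrow> int fps" where
  "fps_alt F = Abs_fps (\<lambda>n. (- 1) ^ n * fps_nth F n)"

lemma fps_alt_mult: "fps_alt (F * G) = fps_alt F * fps_alt G"
proof (rule fps_ext)
  fix n
  have "(- 1) ^ n * (\<Sum>i=0..n. fps_nth F i * fps_nth G (n - i)) =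
      (\<Sum>i=0..n. ((- 1) ^ i * fps_nth F i) * ((- 1) ^ (n - i) * fps_nth G (n - i)))"
    unfolding sum_distrib_left
  proof (rule sum.cong)
    fix i assume "i \<in> {0..n}"
    then have "(- 1 :: int) ^ n = (- 1) ^ i * (- 1) ^ (n - i)" by (simp flip: power_add)
    then show "(- 1) ^ n * (fps_nth F i * fps_nth G (n - i)) =
        (- 1) ^ i * fps_nth F i * ((- 1) ^ (n - i) * fps_nth G (n - i))" by simp
  qed simp
  then show "fps_nth (fps_alt (F * G)) n = fps_nth (fps_alt F * fps_alt G) n"
    by (simp add: fps_alt_def fps_mult_nth)
qed

lemma fps_alt_1 [simp]: "fps_alt 1 = 1"
  by (rule fps_ext) (simp add: fps_alt_def)

lemma fps_alt_X [simp]: "fps_alt fps_X = - fps_X"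
  by (rule fps_ext) (simp add: fps_alt_def fps_X_def)

lemma fps_alt_add: "fps_alt (F + G) = fps_alt F + fps_alt G"
  by (rule fps_ext) (simp add: fps_alt_def algebra_simps)

lemma fps_alt_diff: "fps_alt (F - G) = fps_alt F - fps_alt G"
  by (rule fps_ext) (simp add: fps_alt_def algebra_simps)

lemma fps_alt_power: "fps_alt (F ^ n) = fps_alt F ^ n"
  by (induction n) (simp_all add: fps_alt_mult)

lemma fps_alt_prod: "fps_alt (\<Prod>i\<in>A. F i) = (\<Prod>i\<in>A. fps_alt (F i))"
  by (induction A rule: infinite_finite_induct) (simp_all add: fps_alt_mult)

lemma fps_alt_fps_recip:
  assumes "fps_nth F 0 = 1"
  shows "fps_alt (fps_recip F) = fps_recip (fps_alt F)"
proof (rule fps_recip_unique[symmetric])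
  show "fps_alt F * fps_alt (fps_recip F) = 1" using fps_recip[OF assms] by (simp flip: fps_alt_mult)
  show "fps_nth (fps_alt F) 0 = 1" using assms by (simp add: fps_alt_def)
qed

lemma mock_term_1: "mock_term 1 n = v0_term n"
proof -
  have e: "X * (X\<^sup>2) ^ i = X ^ (2 * i + 1)" for X :: "int fps" and i
    by (simp add: power_mult)
  have "qpoch (- fps_X) (fps_X\<^sup>2) n = mock_num 1 n" "qpoch fps_X (fps_X\<^sup>2) n = mock_den 1 n"
    unfolding qpoch_def mock_num_def mock_den_def
    by (rule prod.reindex_bij_witness[of _ Suc "\<lambda>i. i - 1"]; force simp: e simp flip: power_Suc)+
  then show ?thesis by (simp add: mock_term_def v0_term_def fps_recip_def mult.assoc)
qed

text \<open>Under \<open>q -> -q\<close> the power \<open>q^(n^2)\<close> and the numerator each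
  produce the sign \<open>(-1)^n\<close>. Hence \<open>mock_sum (- 1)\<close> is
  \<open>mock_sum 1\<close> at \<open>-q\<close>, and their sum doubles the even
  coefficients.\<close>

lemma mock_term_minus_1: "mock_term (- 1) n = fps_alt (mock_term 1 n)"
proof -
  have odd_pow: "(- fps_X :: int fps) ^ (2 * i + 1) = - (fps_X ^ (2 * i + 1))" for i
    by simp
  have D: "fps_alt (mock_den 1 n) = mock_den (- 1) n"
    unfolding mock_den_def fps_alt_prod by (simp add: fps_alt_diff fps_alt_power fps_alt_mult odd_pow del: power_Suc add: power_minus_odd)
  have "fps_alt (mock_num 1 n) = (\<Prod>i<n. 1 - fps_X ^ (2 * i + 1))"
    unfolding mock_num_def fps_alt_prod by (simp add: fps_alt_add fps_alt_mult fps_alt_power)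
  also have "(- 1) ^ n * \<dots> = mock_num (- 1) n"
    unfolding mock_num_def by (induction n) (simp_all add: algebra_simps)
  finally have N: "(- 1) ^ n * fps_alt (mock_num 1 n) = mock_num (- 1) n"
    by simp
  have "(- fps_X :: int fps) ^ n\<^sup>2 = (- 1) ^ n\<^sup>2 * fps_X ^ n\<^sup>2"
    by (rule power_minus)
  also have "(- 1 :: int fps) ^ n\<^sup>2 = (- 1) ^ n"
    by (cases "even n") (simp_all)
  finally have "fps_alt (mock_term 1 n) = fps_X ^ n\<^sup>2 * ((- 1) ^ n * fps_alt (mock_num 1 n) * fps_recip (mock_den (- 1) n))"
    unfolding mock_term_def fps_alt_mult by (simp add: fps_alt_power fps_alt_fps_recip D mult_ac)
  then show ?thesis unfolding N mock_term_def by simp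
qed

lemma mock_even_1_nth:
  assumes "even k"
  shows "fps_nth (mock_even 1) k = 2 * v0 k - (if k = 0 then 1 else 0)"
proof -
  have "fps_nth (mock_sum 1) k = v0 k" by (simp add: mock_sum_def mock_term_1 v0_eq_sum)
  moreover have "fps_nth (mock_sum (- 1)) k = v0 k"
    using assms by (simp add: mock_sum_def mock_term_minus_1 fps_alt_def mock_term_1 v0_eq_sum)
  ultimately show ?thesis by (simp add: mock_even_def)
qed

definition v0_gf4 :: "int fps" where "v0_gf4 = Abs_fps (\<lambda>n. v0 (4 * n))"

lemma v0_gf4_phi_neg: "(2 * v0_gf4 - 1) * phi_neg = phi ^ 2"
proof -
  have "section_fps 4 0 (mock_even 1) = 2 * v0_gf4 - 1"
    by (rule fps_ext) (simp add: mock_even_1_nth v0_gf4_def)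
  then show ?thesis using mock_even_1_section4 by simp
qed

section \<open>Extraction of the exponents 32n + 4\<close>

lemma section_fps_2_split:
  "section_fps 2 0 (dilate 2 F + fps_X * dilate 2 G) = F" "section_fps 2 1 (dilate 2 F + fps_X * dilate 2 G) = G"
  using section_fps_X_dilate[of 0 2 0 F] section_fps_X_dilate[of 0 2 1 G] section_fps_X_dilate[of 1 2 0 F] section_fps_X_dilate[of 1 2 1 G]
  by (simp_all add: section_fps_add)

text \<open>Rationalises the denominator \<open>phi_neg\<close>: three uses of
  \<open>phi_phi_neg\<close> turn it into a series in \<open>q^8\<close>, enough for three
  successive 2-dissections.\<close>

lemma phi_neg_norm8: "phi_neg * phi * dilate 2 phi ^ 2 * dilate 4 phi ^ 4 = dilate 8 phi_neg ^ 8"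
proof -
  have 2: "dilate 2 phi * dilate 2 phi_neg = dilate 4 phi_neg ^ 2"
    using arg_cong[OF phi_phi_neg, of "dilate 2"] by (simp add: dilate_simps)
  have 4: "dilate 4 phi * dilate 4 phi_neg = dilate 8 phi_neg ^ 2"
    using arg_cong[OF phi_phi_neg, of "dilate 4"] by (simp add: dilate_simps)
  have "phi_neg * phi * dilate 2 phi ^ 2 * dilate 4 phi ^ 4 = (phi * phi_neg) * dilate 2 phi ^ 2 * dilate 4 phi ^ 4"
    by (simp only: mult_ac)
  also have "\<dots> = (dilate 2 phi * dilate 2 phi_neg) ^ 2 * dilate 4 phi ^ 4"
    unfolding phi_phi_neg by Groebner_Basis.algebra
  also have "\<dots> = (dilate 4 phi * dilate 4 phi_neg) ^ 4" unfolding 2 by Groebner_Basis.algebra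
  finally show ?thesis unfolding 4 by (simp flip: power_mult)
qed

lemma v0_gf4_dilate8: "dilate 8 phi_neg ^ 8 * (2 * v0_gf4 - 1) = phi ^ 3 * dilate 2 phi ^ 2 * dilate 4 phi ^ 4"
proof -
  have "dilate 8 phi_neg ^ 8 * (2 * v0_gf4 - 1) =
      ((2 * v0_gf4 - 1) * phi_neg) * phi * dilate 2 phi ^ 2 * dilate 4 phi ^ 4"
    unfolding phi_neg_norm8[symmetric] by Groebner_Basis.algebra
  then show ?thesis unfolding v0_gf4_phi_neg by (simp add: power2_eq_square power3_eq_cube mult.assoc)
qed

text \<open>Jacobi's quartic identity: the squares of \<open>A + B\<close> and \<open>A - B\<close>
  from \<open>phi_square\<close> and \<open>phi_neg_square\<close> differ by
  \<open>4 A B\<close>.\<close>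

lemma phi4_diff: "phi ^ 4 = phi_neg ^ 4 + 16 * (fps_X * dilate 2 psi ^ 4)"
proof -
  have "dilate 2 psi ^ 2 = dilate 2 phi * dilate 4 psi"
    using arg_cong[OF psi_square, of "dilate 2"] by (simp add: dilate_simps)
  then have "dilate 2 psi ^ 4 = (dilate 2 phi * dilate 4 psi) ^ 2"
    by (metis power_mult numeral_times_numeral semiring_norm(12) semiring_norm(13))
  moreover have "phi ^ 4 = (phi ^ 2) ^ 2" "phi_neg ^ 4 = (phi_neg ^ 2) ^ 2" by simp_all
  moreover have "(dilate 2 phi ^ 2 + 4 * fps_X * dilate 4 psi ^ 2) ^ 2 =
      (dilate 2 phi ^ 2 - 4 * fps_X * dilate 4 psi ^ 2) ^ 2 + 16 * (fps_X * (dilate 2 phi * dilate 4 psi) ^ 2)"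
    by Groebner_Basis.algebra
  ultimately show ?thesis unfolding phi_square phi_neg_square by simp
qed

definition v0_gf32 :: "int fps" where "v0_gf32 = Abs_fps (\<lambda>n. v0 (32 * n + 4))"

text \<open>As \<open>32 n + 4 = 4 (8 n + 1)\<close>, the coefficients of \<open>v0_gf4\<close> at
  \<open>8 n + 1\<close> are wanted: the odd part, then twice the even part. After each extraction,
  \<open>phi2\<close> and \<open>c2\<close> express the remaining series through series in
  \<open>q^2\<close> again.\<close>

lemma v0_gf32_phi_neg: "phi_neg ^ 8 * v0_gf32 = 3 * psi * phi_neg ^ 8 + 512 * fps_X * psi ^ 9"
proof -
  define Y where "Y = 2 * v0_gf4 - 1"
  define a b c where "a = dilate 2 phi" and "b = dilate 4 psi" and "c = dilate 2 psi"
  have ext_abc: "a = dilate 2 phi" "b = dilate 2 c" "c = dilate 2 psi" "dilate 2 a = dilate 4 phi" "dilate 2 b = dilate 8 psi"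
    by (simp_all add: a_def b_def c_def dilate_simps)
  have phi2: "phi ^ 2 = a ^ 2 + 4 * fps_X * b ^ 2"
    using phi_square by (simp add: a_def b_def)
  have c2: "c ^ 2 = a * b"
    using arg_cong[OF psi_square, of "dilate 2"] by (simp add: dilate_simps a_def b_def c_def)
  have "dilate 2 (dilate 4 phi_neg ^ 8) * Y =
      (dilate 2 a + 2 * fps_X * dilate 2 b) ^ 3 * dilate 2 phi ^ 2 * dilate 4 phi ^ 4"
    using v0_gf4_dilate8 phi_dissect2 by (simp add: dilate_simps ext_abc(4,5) Y_def)
  also have "\<dots> = dilate 2 ((a ^ 3 + 12 * fps_X * a * b ^ 2) * phi ^ 2 * a ^ 4) +
      fps_X * dilate 2 ((6 * a ^ 2 * b + 8 * fps_X * b ^ 3) * phi ^ 2 * a ^ 4)"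
    by (simp add: dilate_add dilate_mult dilate_power flip: ext_abc(4)) Groebner_Basis.algebra
  finally have "dilate 4 phi_neg ^ 8 * section_fps 2 1 Y = (6 * a ^ 2 * b + 8 * fps_X * b ^ 3) * phi ^ 2 * a ^ 4"
    using section_fps_dilate_mult[of 1 2 "dilate 4 phi_neg ^ 8" Y] section_fps_2_split(2) by simp
  also have "\<dots> = dilate 2 (6 * phi ^ 8 * c + 32 * fps_X * phi ^ 4 * c ^ 5) +
      fps_X * dilate 2 (32 * phi ^ 6 * c ^ 3)"
    unfolding phi2 by (simp add: dilate_add dilate_mult dilate_power flip: ext_abc(1,2)) Groebner_Basis.algebra
  finally have "dilate 2 (dilate 2 phi_neg ^ 8) * section_fps 2 1 Y = dilate 2 (6 * phi ^ 8 * c + 32 * fps_X * phi ^ 4 * c ^ 5) +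
      fps_X * dilate 2 (32 * phi ^ 6 * c ^ 3)"
    by (simp add: dilate_simps)
  then have "dilate 2 phi_neg ^ 8 * section_fps 2 0 (section_fps 2 1 Y) = 6 * phi ^ 8 * c + 32 * fps_X * phi ^ 4 * c ^ 5"
    using section_fps_dilate_mult[of 0 2 "dilate 2 phi_neg ^ 8" "section_fps 2 1 Y"] section_fps_2_split(1) by simp
  also have "\<dots> = c * (6 * (phi ^ 2) ^ 4 + 32 * fps_X * (phi ^ 2) ^ 2 * (c ^ 2) ^ 2)"
    by Groebner_Basis.algebra
  also have "\<dots> = c * (6 * a ^ 8 + 832 * fps_X ^ 2 * a ^ 4 * b ^ 4 + 1536 * fps_X ^ 4 * b ^ 8) +
      fps_X * (c * (128 * a ^ 6 * b ^ 2 + 2048 * fps_X ^ 2 * a ^ 2 * b ^ 6))"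
    unfolding phi2 c2 by Groebner_Basis.algebra
  also have "\<dots> = dilate 2 (psi * (6 * phi ^ 8 + 832 * fps_X * phi ^ 4 * c ^ 4 + 1536 * fps_X ^ 2 * c ^ 8)) +
      fps_X * dilate 2 (psi * (128 * phi ^ 6 * c ^ 2 + 2048 * fps_X * phi ^ 2 * c ^ 6))"
    by (simp add: dilate_add dilate_mult dilate_power flip: ext_abc(1,2,3) power_mult)
  finally have "dilate 2 (phi_neg ^ 8) * section_fps 2 0 (section_fps 2 1 Y) = \<dots>" by (simp add: dilate_simps)
  then have "phi_neg ^ 8 * section_fps 2 0 (section_fps 2 0 (section_fps 2 1 Y)) =
      psi * (6 * phi ^ 8 + 832 * fps_X * phi ^ 4 * c ^ 4 + 1536 * fps_X ^ 2 * c ^ 8)"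
    using section_fps_dilate_mult[of 0 2 "phi_neg ^ 8" "section_fps 2 0 (section_fps 2 1 Y)"] section_fps_2_split(1) by simp
  also have "\<dots> = psi * (6 * (phi ^ 4) ^ 2 + 832 * phi ^ 4 * (fps_X * c ^ 4) + 1536 * (fps_X * c ^ 4) ^ 2)"
    by Groebner_Basis.algebra
  \<comment> \<open>Once \<open>phi ^ 4\<close> is replaced by \<open>phi4_diff\<close>, everything
    beyond the leading term is a multiple of \<open>c ^ 4 * phi ^ 4\<close>, which is
    \<open>psi ^ 8\<close>.\<close>
  also have "\<dots> = psi * (6 * phi_neg ^ 8 + 1024 * fps_X * (c ^ 4 * (phi_neg ^ 4 + 16 * (fps_X * c ^ 4))))"
    unfolding phi4_diff c_def[symmetric] by Groebner_Basis.algebra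
  also have "c ^ 4 * (phi_neg ^ 4 + 16 * (fps_X * c ^ 4)) = psi ^ 8"
  proof -
    have "psi ^ 8 = (psi ^ 2) ^ 4" by (simp flip: power_mult)
    also have "\<dots> = c ^ 4 * phi ^ 4" unfolding psi_square c_def by (simp add: power_mult_distrib)
    finally show ?thesis by (simp add: phi4_diff c_def)
  qed
  \<comment> \<open>The summand \<open>- 1\<close> of \<open>Y\<close> has no odd exponent and drops
    out.\<close>
  also have "section_fps 2 0 (section_fps 2 0 (section_fps 2 1 Y)) = 2 * v0_gf32"
    by (rule fps_ext) (simp add: Y_def v0_gf32_def v0_gf4_def algebra_simps)
  finally have "2 * (phi_neg ^ 8 * v0_gf32) = 2 * (3 * psi * phi_neg ^ 8 + 512 * fps_X * psi ^ 9)"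
    by (simp add: algebra_simps eval_nat_numeral)
  then show ?thesis by (metis mult_left_cancel zero_neq_numeral)
qed

section \<open>Congruences modulo 27\<close>

lemma numeral_dvd_fps: "(numeral m :: int fps) dvd F \<longleftrightarrow> (\<forall>n. numeral m dvd fps_nth F n)"
proof
  assume "\<forall>n. numeral m dvd fps_nth F n"
  then have "F = numeral m * Abs_fps (\<lambda>n. fps_nth F n div numeral m)"
    by (intro fps_ext) simp
  then show "numeral m dvd F" by (rule dvdI)
qed (auto elim!: dvdE)

lemma dvd_unit_cancel:
  assumes "d dvd F * Q" "fps_nth Q 0 = 1"
  shows "d dvd (F :: int fps)"
proof -
  obtain R where "Q * R = 1" using unit_inverse[OF assms(2)] .
  moreover have "d dvd F * Q * R" using assms(1) by (rule dvd_mult2)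
  ultimately show ?thesis by (simp add: mult.assoc)
qed

lemma section_fps_dvd: "(numeral m :: int fps) dvd F \<Longrightarrow> numeral m dvd section_fps k r F"
  by (simp add: numeral_dvd_fps)

lemma cube_cong: "(3::int) dvd c ^ 3 - c"
proof -
  have "c mod 3 = 0 \<or> c mod 3 = 1 \<or> c mod 3 = 2" by presburger
  then have "c ^ 3 mod 3 = c mod 3"
    by (elim disjE) (simp_all add: power_mod[of c 3 3, symmetric])
  then show ?thesis by (simp add: mod_eq_dvd_iff)
qed

text \<open>For polynomials this is Fermat's congruence for the coefficients together with the
  factor 3 in the mixed terms of a cube; each coefficient of \<open>F ^ 3\<close> depends only on a
  truncation of \<open>F\<close>.\<close>

lemma frobenius3: "3 dvd F ^ 3 - dilate 3 F"
proof -
  have poly: "3 dvd (\<Sum>i<n. fps_const (f i) * fps_X ^ i) ^ 3 - (\<Sum>i<n. fps_const (f i) * fps_X ^ (3 * i))"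
    for f :: "nat \<Rightarrow> int" and n
  proof (induction n)
    case (Suc n)
    let ?P = "\<Sum>i<n. fps_const (f i) * fps_X ^ i" and ?c = "fps_const (f n)" and ?X = "fps_X ^ n :: int fps"
    have "3 dvd fps_const (f n ^ 3 - f n)"
      using cube_cong[of "f n"] by (simp add: numeral_dvd_fps)
    then have "3 dvd (?c ^ 3 - ?c) * ?X ^ 3"
      by (intro dvd_mult2) (simp add: fps_const_power fps_const_sub)
    moreover have "3 dvd 3 * (?P ^ 2 * (?c * ?X) + ?P * (?c * ?X) ^ 2)" by simp
    ultimately have "3 dvd ?P ^ 3 - (\<Sum>i<n. fps_const (f i) * fps_X ^ (3 * i)) + (?c ^ 3 - ?c) * ?X ^ 3 +
        3 * (?P ^ 2 * (?c * ?X) + ?P * (?c * ?X) ^ 2)"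
      using Suc by (intro dvd_add)
    also have "\<dots> = (?P + ?c * ?X) ^ 3 - (\<Sum>i<n. fps_const (f i) * fps_X ^ (3 * i)) - ?c * ?X ^ 3"
      by Groebner_Basis.algebra
    also have "?X ^ 3 = fps_X ^ (3 * n)" by (simp add: mult.commute flip: power_mult)
    finally show ?case by (simp add: algebra_simps)
  qed simp
  have "3 dvd fps_nth (F ^ 3 - dilate 3 F) k" for k
  proof -
    let ?P = "\<Sum>i<Suc k. fps_const (fps_nth F i) * fps_X ^ i"
    have P: "eq_upto (Suc k) F ?P"
      by (auto simp: eq_upto_def fps_sum_nth if_distrib[of "\<lambda>x. _ * x"] cong: if_cong)
    have "eq_upto (Suc k) (F ^ 3) (?P ^ 3)"
      unfolding power3_eq_cube by (intro eq_upto_mult P)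
    moreover have "dilate 3 ?P = (\<Sum>i<Suc k. fps_const (fps_nth F i) * fps_X ^ (3 * i))"
    proof -
      have *: "dilate 3 (\<Sum>i\<in>A. G i) = (\<Sum>i\<in>A. dilate 3 (G i))" for A and G :: "nat \<Rightarrow> int fps"
        by (simp add: dilate_def fps_compose_sum_distrib)
      show ?thesis
        unfolding * by (intro sum.cong) (simp_all add: dilate_mult dilate_power flip: power_mult)
    qed
    moreover have "eq_upto (Suc k) (dilate 3 F) (dilate 3 ?P)"
      using P by (rule eq_upto_dilate) simp
    ultimately have "eq_upto (Suc k) (F ^ 3 - dilate 3 F)
        (?P ^ 3 - (\<Sum>i<Suc k. fps_const (fps_nth F i) * fps_X ^ (3 * i)))"
      by (simp only: eq_upto_diff)
    moreover have "3 dvd fps_nth (?P ^ 3 - (\<Sum>i<Suc k. fps_const (fps_nth F i) * fps_X ^ (3 * i))) k"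
      using poly[of "fps_nth F" "Suc k"] unfolding numeral_dvd_fps by blast
    ultimately show ?thesis by (simp only: eq_upto_def lessI)
  qed
  then show ?thesis by (simp add: numeral_dvd_fps)
qed

lemma power8_mod27:
  fixes c p :: "'a :: idom"
  shows "(c + 3 * p) ^ 8 = c ^ 8 + 24 * c ^ 7 * p + 252 * c ^ 6 * p ^ 2 +
    27 * (p ^ 3 * (56 * c ^ 5 + 210 * c ^ 4 * p + 504 * c ^ 3 * p ^ 2 + 756 * c ^ 2 * p ^ 3 +
      648 * c * p ^ 4 + 243 * p ^ 5))"
  by Groebner_Basis.algebra

text \<open>Let \<open>a\<close> and \<open>x\<close> have exponents 0 and 1 modulo 3. Modulo 27 the
  product has no component in class 2, and its class 0 component contains the eighth power that is
  also the rationalised denominator. Both bases are \<open>c\<close> plus a multiple of 3: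
  \<open>(a + x) (a^2 + 2 a x + 4 x^2) = c + 3 p\<close> and \<open>a^3 - 8 x^3 = c + 3 z\<close>.
  The constant 2016 is \<open>252 * 8\<close>, where 8 is the coefficient of \<open>a^3 x^4\<close>
  in \<open>(a + x) p^2\<close>.\<close>

lemma multisection_mod27:
  fixes a x :: "int fps"
  defines "c \<equiv> a ^ 3 + 4 * x ^ 3"
  shows "27 dvd (a + x) ^ 9 * (a ^ 2 + 2 * a * x + 4 * x ^ 2) ^ 8 - a * (a ^ 3 - 8 * x ^ 3) ^ 8 -
    x * (c ^ 8 + 24 * c ^ 7 * a ^ 3 + 2016 * c ^ 6 * a ^ 3 * x ^ 3)"
proof -
  define p where "p = a ^ 2 * x + 2 * a * x ^ 2"
  define r where "r = p ^ 3 * (56 * c ^ 5 + 210 * c ^ 4 * p + 504 * c ^ 3 * p ^ 2 + 756 * c ^ 2 * p ^ 3 +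
      648 * c * p ^ 4 + 243 * p ^ 5)"
  define z where "z = - 4 * x ^ 3"
  define t where "t = z ^ 3 * (56 * c ^ 5 + 210 * c ^ 4 * z + 504 * c ^ 3 * z ^ 2 + 756 * c ^ 2 * z ^ 3 +
      648 * c * z ^ 4 + 243 * z ^ 5)"
  have 1: "(a + x) ^ 9 * (a ^ 2 + 2 * a * x + 4 * x ^ 2) ^ 8 = (a + x) * (c + 3 * p) ^ 8"
  proof -
    have "(a + x) * (a ^ 2 + 2 * a * x + 4 * x ^ 2) = c + 3 * p"
      unfolding c_def p_def by Groebner_Basis.algebra
    moreover have "(a + x) ^ 9 = (a + x) * (a + x) ^ 8"
      by (simp add: power_Suc[symmetric] del: power_Suc)
    ultimately show ?thesis by (simp add: mult.assoc flip: power_mult_distrib)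
  qed
  have 2: "a ^ 3 - 8 * x ^ 3 = c + 3 * z" by (simp add: c_def z_def)

  have "(a + x) * (c ^ 8 + 24 * c ^ 7 * p + 252 * c ^ 6 * p ^ 2) -
      a * (c ^ 8 + 24 * c ^ 7 * z + 252 * c ^ 6 * z ^ 2) -
      x * (c ^ 8 + 24 * c ^ 7 * a ^ 3 + 2016 * c ^ 6 * a ^ 3 * x ^ 3) =
      c ^ 6 * (24 * c * ((a + x) * p - a ^ 3 * x - a * z) +
        252 * ((a + x) * p ^ 2 - 8 * a ^ 3 * x ^ 4 - a * z ^ 2))"
    by Groebner_Basis.algebra
  also have "(a + x) * p - a ^ 3 * x - a * z = 3 * a ^ 2 * x ^ 2 + 6 * a * x ^ 3"
    unfolding p_def z_def by Groebner_Basis.algebra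
  also have "(a + x) * p ^ 2 - 8 * a ^ 3 * x ^ 4 - a * z ^ 2 =
      a ^ 2 * x ^ 2 * c + a * x ^ 3 * (5 * c - 36 * x ^ 3)"
    unfolding p_def z_def c_def by Groebner_Basis.algebra
  \<comment> \<open>Here \<open>72 + 252 = 27 * 12\<close>, \<open>144 + 1260 = 27 * 52\<close> and
    \<open>252 * 36 = 27 * 336\<close>.\<close>
  also have "c ^ 6 * (24 * c * (3 * a ^ 2 * x ^ 2 + 6 * a * x ^ 3) +
      252 * (a ^ 2 * x ^ 2 * c + a * x ^ 3 * (5 * c - 36 * x ^ 3))) =
      27 * (c ^ 6 * (12 * c * a ^ 2 * x ^ 2 + 52 * c * a * x ^ 3 - 336 * a * x ^ 6))"
    by Groebner_Basis.algebra
  finally have 3: "(a + x) * (c ^ 8 + 24 * c ^ 7 * p + 252 * c ^ 6 * p ^ 2) -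
      a * (c ^ 8 + 24 * c ^ 7 * z + 252 * c ^ 6 * z ^ 2) -
      x * (c ^ 8 + 24 * c ^ 7 * a ^ 3 + 2016 * c ^ 6 * a ^ 3 * x ^ 3) =
      27 * (c ^ 6 * (12 * c * a ^ 2 * x ^ 2 + 52 * c * a * x ^ 3 - 336 * a * x ^ 6))" .
  have collect: "(a + x) * (l + 27 * r) - a * (m + 27 * t) - n = (l' + 27 * ((a + x) * r - a * t))"
    if "(a + x) * l - a * m - n = l'" for l m n l'
    unfolding that[symmetric] by Groebner_Basis.algebra
  have "(a + x) ^ 9 * (a ^ 2 + 2 * a * x + 4 * x ^ 2) ^ 8 - a * (a ^ 3 - 8 * x ^ 3) ^ 8 -
    x * (c ^ 8 + 24 * c ^ 7 * a ^ 3 + 2016 * c ^ 6 * a ^ 3 * x ^ 3) =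
    27 * (c ^ 6 * (12 * c * a ^ 2 * x ^ 2 + 52 * c * a * x ^ 3 - 336 * a * x ^ 6) + ((a + x) * r - a * t))"
    unfolding 1 2 power8_mod27[of c] r_def[symmetric] t_def[symmetric] collect[OF 3] distrib_left[of 27] ..
  then show ?thesis by (rule dvdI)
qed

definition psi_phi_quot :: "int fps" where "psi_phi_quot = fps_X * psi ^ 9 * fps_recip phi_neg ^ 8"

lemma phi_neg_nth_0 [simp]: "fps_nth phi_neg 0 = 1"
  unfolding phi_neg_prod by (simp add: fps_nth_power_0)

lemma omega_nth_0 [simp]: "fps_nth omega 0 = 1"
  unfolding omega_prod by simp

lemma phi_neg_fps_recip: "phi_neg * fps_recip phi_neg = 1"
  by (simp add: fps_recip)

lemma psi_phi_quot_phi_neg: "psi_phi_quot * phi_neg ^ 8 = fps_X * psi ^ 9"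
proof -
  have "psi_phi_quot * phi_neg ^ 8 = fps_X * psi ^ 9 * (phi_neg * fps_recip phi_neg) ^ 8"
    unfolding psi_phi_quot_def by Groebner_Basis.algebra
  then show ?thesis by (simp add: phi_neg_fps_recip)
qed

lemma v0_gf32_eq: "v0_gf32 = 3 * psi + 512 * psi_phi_quot"
proof (rule fps_mult_right_cancelI)
  show "v0_gf32 * phi_neg ^ 8 = (3 * psi + 512 * psi_phi_quot) * phi_neg ^ 8"
    using v0_gf32_phi_neg by (simp add: algebra_simps psi_phi_quot_phi_neg)
  have "fps_nth (phi_neg ^ 8) 0 \<noteq> 0" by (simp add: fps_nth_power_0)
  then show "phi_neg ^ 8 \<noteq> 0" by (metis fps_zero_nth)
qed

text \<open>With \<open>q^3\<close> for \<open>q\<close> this is the norm of \<open>phi_neg\<close>,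
  the product of its three conjugates under \<open>q -> \<zeta> q\<close> with
  \<open>\<zeta>^3 = 1\<close>.\<close>

definition cubic_diff :: "int fps" where "cubic_diff = dilate 3 phi_neg ^ 3 - 8 * fps_X * omega ^ 3"

lemma cubic_diff_nth_0: "fps_nth cubic_diff 0 = 1"
  by (simp add: cubic_diff_def dilate_nth fps_nth_power_0 mult.assoc)

section \<open>Trisections of \<open>q psi^9 / phi_neg^8\<close> modulo 27\<close>

context
  fixes a b s x :: "int fps"
  defines "a \<equiv> dilate 9 phi_neg" and "b \<equiv> dilate 3 omega" and "s \<equiv> dilate 9 psi" and "x \<equiv> fps_X * dilate 3 omega"
begin

lemma phi_neg_ax: "phi_neg = a - 2 * x"
  using phi_neg_dissect3 by (simp add: a_def x_def mult.assoc)

lemma psi_b: "psi * b = s * (a + x)"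
proof -
  have "dilate 3 pent * b = s * a"
    using arg_cong[OF omega_pent, of "dilate 3"] by (simp add: dilate_simps a_def b_def s_def mult.commute)
  moreover have "psi * b = dilate 3 pent * b + s * x"
    by (subst psi_dissect3) (simp add: x_def s_def b_def algebra_simps)
  ultimately show ?thesis by (simp add: algebra_simps)
qed

lemma norm_ax: "phi_neg * (a ^ 2 + 2 * a * x + 4 * x ^ 2) = a ^ 3 - 8 * x ^ 3"
  unfolding phi_neg_ax by Groebner_Basis.algebra

lemma dilate_cubic_diff: "dilate 3 cubic_diff = a ^ 3 - 8 * x ^ 3"
  by (simp add: cubic_diff_def a_def x_def dilate_simps power_mult_distrib)

text \<open>The leading factor \<open>q\<close> shifts the components of
  \<open>multisection_mod27\<close> by one: class 0 lands at \<open>3 n + 1\<close>, class 1 at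
  \<open>3 n + 2\<close>, and the missing class 2 leaves nothing at \<open>3 n\<close>.\<close>

lemma psi_phi_quot_sections:
  shows "27 dvd section_fps 3 0 psi_phi_quot"
    and "27 dvd omega ^ 9 * section_fps 3 1 psi_phi_quot - dilate 3 phi_neg * dilate 3 psi ^ 9"
proof -
  define c where "c = dilate 3 phi_neg ^ 3 + 4 * fps_X * omega ^ 3"
  define k where "k = c ^ 8 + 24 * c ^ 7 * dilate 3 phi_neg ^ 3 + 2016 * c ^ 6 * dilate 3 phi_neg ^ 3 * (fps_X * omega ^ 3)"
  have ext_c: "dilate 3 c = a ^ 3 + 4 * x ^ 3"
    by (simp add: c_def a_def x_def dilate_simps power_mult_distrib)
  have ext_k: "dilate 3 k = dilate 3 c ^ 8 + 24 * dilate 3 c ^ 7 * a ^ 3 + 2016 * dilate 3 c ^ 6 * a ^ 3 * x ^ 3"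
    by (simp add: k_def a_def x_def dilate_simps power_mult_distrib)
  obtain Z where "(a + x) ^ 9 * (a ^ 2 + 2 * a * x + 4 * x ^ 2) ^ 8 - a * (a ^ 3 - 8 * x ^ 3) ^ 8 - x * dilate 3 k = 27 * Z"
    using multisection_mod27[of a x] unfolding ext_k ext_c by (elim dvdE)
  then have Z: "(a + x) ^ 9 * (a ^ 2 + 2 * a * x + 4 * x ^ 2) ^ 8 = a * dilate 3 cubic_diff ^ 8 + x * dilate 3 k + 27 * Z"
    unfolding dilate_cubic_diff by (simp add: algebra_simps)
  \<comment> \<open>The factor \<open>b ^ 9\<close> turns \<open>psi ^ 9\<close> into
    \<open>s ^ 9 * (a + x) ^ 9\<close>, and the eighth power of the norm clears the
    denominator.\<close>
  have "psi_phi_quot * (b ^ 9 * dilate 3 cubic_diff ^ 8) = psi_phi_quot * phi_neg ^ 8 * b ^ 9 * (a ^ 2 + 2 * a * x + 4 * x ^ 2) ^ 8"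
    unfolding dilate_cubic_diff norm_ax[symmetric] by Groebner_Basis.algebra
  also have "\<dots> = fps_X * (psi * b) ^ 9 * (a ^ 2 + 2 * a * x + 4 * x ^ 2) ^ 8"
    unfolding psi_phi_quot_phi_neg by Groebner_Basis.algebra
  also have "\<dots> = fps_X * s ^ 9 * ((a + x) ^ 9 * (a ^ 2 + 2 * a * x + 4 * x ^ 2) ^ 8)"
    unfolding psi_b by Groebner_Basis.algebra
  also have "\<dots> = fps_X ^ 1 * (s ^ 9 * a * dilate 3 cubic_diff ^ 8) + fps_X ^ 2 * (s ^ 9 * b * dilate 3 k) + 27 * (fps_X * s ^ 9 * Z)"
    unfolding Z unfolding x_def b_def[symmetric] by Groebner_Basis.algebra
  also have "s ^ 9 * a * dilate 3 cubic_diff ^ 8 = dilate 3 (dilate 3 psi ^ 9 * dilate 3 phi_neg * cubic_diff ^ 8)"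
    by (simp add: dilate_simps s_def a_def)
  also have "s ^ 9 * b * dilate 3 k = dilate 3 (dilate 3 psi ^ 9 * omega * k)"
    by (simp add: dilate_simps s_def b_def)
  finally have eq: "dilate 3 (omega ^ 9 * cubic_diff ^ 8) * psi_phi_quot =
      fps_X ^ 1 * dilate 3 (dilate 3 psi ^ 9 * dilate 3 phi_neg * cubic_diff ^ 8) +
      fps_X ^ 2 * dilate 3 (dilate 3 psi ^ 9 * omega * k) + 27 * (fps_X * s ^ 9 * Z)"
    by (simp add: dilate_simps b_def mult.commute)
  have u: "fps_nth (omega ^ 9 * cubic_diff ^ 8) 0 = 1" "fps_nth (cubic_diff ^ 8) 0 = 1"
    by (simp_all add: fps_nth_power_0 cubic_diff_nth_0)
  have "omega ^ 9 * cubic_diff ^ 8 * section_fps 3 0 psi_phi_quot = section_fps 3 0 (27 * (fps_X * s ^ 9 * Z))"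
    using arg_cong[OF eq, of "section_fps 3 0"]
    by (simp only: section_fps_dilate_mult zero_less_numeral section_fps_add section_fps_X_dilate) simp
  then have "27 dvd section_fps 3 0 psi_phi_quot * (omega ^ 9 * cubic_diff ^ 8)"
    using section_fps_dvd[of _ "27 * (fps_X * s ^ 9 * Z)" 3 0] by (simp add: mult.commute)
  then show "27 dvd section_fps 3 0 psi_phi_quot" by (rule dvd_unit_cancel) (rule u)
  have "omega ^ 9 * cubic_diff ^ 8 * section_fps 3 1 psi_phi_quot =
      dilate 3 psi ^ 9 * dilate 3 phi_neg * cubic_diff ^ 8 + section_fps 3 1 (27 * (fps_X * s ^ 9 * Z))"
    using arg_cong[OF eq, of "section_fps 3 1"] section_fps_dilate_mult[of 1 3 "omega ^ 9 * cubic_diff ^ 8" psi_phi_quot]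
      section_fps_X_dilate[of 1 3 1] section_fps_X_dilate[of 1 3 2]
    by (simp add: section_fps_add)
  then have "(omega ^ 9 * section_fps 3 1 psi_phi_quot - dilate 3 phi_neg * dilate 3 psi ^ 9) * cubic_diff ^ 8 = section_fps 3 1 (27 * (fps_X * s ^ 9 * Z))"
    by (simp add: algebra_simps)
  then have "27 dvd (omega ^ 9 * section_fps 3 1 psi_phi_quot - dilate 3 phi_neg * dilate 3 psi ^ 9) * cubic_diff ^ 8"
    using section_fps_dvd[of _ "27 * (fps_X * s ^ 9 * Z)" 3 1] by simp
  then show "27 dvd omega ^ 9 * section_fps 3 1 psi_phi_quot - dilate 3 phi_neg * dilate 3 psi ^ 9"
    by (rule dvd_unit_cancel) (rule u)
qed

text \<open>Multiplying the preceding congruence by \<open>pent ^ 9 * phi_neg ^ 3\<close> lets the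
  two product identities remove \<open>omega\<close> and \<open>pent\<close>. Only cubes of
  \<open>psi\<close> and \<open>phi_neg\<close> remain, which makes a second trisection
  easy.\<close>

lemma psi_phi_quot_section1: "27 dvd phi_neg ^ 3 * section_fps 3 1 psi_phi_quot - dilate 3 phi_neg * psi ^ 3"
proof -
  let ?S = "section_fps 3 1 psi_phi_quot" and ?a = "dilate 3 phi_neg" and ?s = "dilate 3 psi"
  have a0: "fps_nth (?a ^ n) 0 = 1" for n by (simp add: dilate_nth fps_nth_power_0)
  have s0: "?s \<noteq> 0"
  proof
    assume "?s = 0"
    then have "dilate 3 psi = dilate 3 0" by (simp add: dilate_def)
    then have "psi = 0" by (simp add: dilate_inject)
    then have "euler 2 ^ 2 = 0" using psi_E by simp
    then show False by simp
  qed
  have "27 dvd (omega ^ 9 * ?S - ?a * ?s ^ 9) * (pent ^ 9 * phi_neg ^ 3)"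
    using psi_phi_quot_sections(2) by (rule dvd_mult2)
  also have "(omega ^ 9 * ?S - ?a * ?s ^ 9) * (pent ^ 9 * phi_neg ^ 3) =
      (omega * pent) ^ 9 * ?S * phi_neg ^ 3 - ?a * ?s ^ 9 * (phi_neg * pent ^ 3) ^ 3"
    by Groebner_Basis.algebra
  also have "\<dots> = ?s ^ 9 * ((phi_neg ^ 3 * ?S - ?a * psi ^ 3) * ?a ^ 9)"
    unfolding omega_pent psi_phi_neg_pent[symmetric] by Groebner_Basis.algebra
  finally have "27 dvd ((phi_neg ^ 3 * ?S - ?a * psi ^ 3) * ?s ^ 9) * ?a ^ 9"
    by (simp only: mult_ac)
  then have "27 dvd (phi_neg ^ 3 * ?S - ?a * psi ^ 3) * ?s ^ 9"
    by (rule dvd_unit_cancel) (rule a0)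
  moreover have "fps_nth (?s ^ 9) 0 = 1"
    unfolding psi_prod by (simp add: fps_nth_power_0 dilate_nth)
  ultimately show ?thesis by (rule dvd_unit_cancel)
qed

text \<open>In \<open>(c + 3 p)^3\<close>, with \<open>c\<close> taken at \<open>q^3\<close>, only
  the cube and \<open>9 c^2 p\<close> survive modulo 27, and \<open>p\<close> has no component in
  class 0. The extracted series is therefore \<open>psi * c ^ 3 / cubic_diff ^ 3\<close>.\<close>

lemma psi_phi_quot_section10: "27 dvd section_fps 3 0 (section_fps 3 1 psi_phi_quot) - (psi + 9 * (fps_X * s))"
proof -
  let ?S = "section_fps 3 1 psi_phi_quot" and ?a = "dilate 3 phi_neg" and ?s = "dilate 3 psi"
  let ?W = "section_fps 3 0 ?S"
  define k where "k = fps_X * omega ^ 3"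
  \<comment> \<open>From \<open>a^3 + 4 x^3 = (a^3 - 8 x^3) + 12 x^3\<close>, so that
    \<open>c ^ 3\<close> can be expanded around the unit \<open>cubic_diff\<close>.\<close>
  define c where "c = cubic_diff + 12 * k"
  define p where "p = a ^ 2 * x + 2 * a * x ^ 2"
  have c': "dilate 3 c = a ^ 3 + 4 * x ^ 3"
    by (simp add: c_def k_def cubic_diff_def a_def x_def dilate_simps power_mult_distrib)
  have p: "(a + x) * (a ^ 2 + 2 * a * x + 4 * x ^ 2) = dilate 3 c + 3 * p"
    unfolding c' p_def by Groebner_Basis.algebra
  obtain Z where Z: "phi_neg ^ 3 * ?S - ?a * psi ^ 3 = 27 * Z"
    using psi_phi_quot_section1 by (elim dvdE)
  let ?N = "a ^ 2 + 2 * a * x + 4 * x ^ 2"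
  have "dilate 3 (cubic_diff ^ 3 * omega ^ 3) = (phi_neg * ?N) ^ 3 * b ^ 3"
    by (simp add: dilate_simps dilate_cubic_diff norm_ax b_def)
  then have "dilate 3 (cubic_diff ^ 3 * omega ^ 3) * ?S = (phi_neg ^ 3 * ?S) * (?N * b) ^ 3"
    by (simp add: power_mult_distrib mult_ac)
  also have "\<dots> = (?a * psi ^ 3 + 27 * Z) * (?N * b) ^ 3"
    using Z by (simp add: algebra_simps)
  also have "\<dots> = ?a * (psi * b) ^ 3 * ?N ^ 3 + 27 * (Z * (?N * b) ^ 3)"
    by Groebner_Basis.algebra
  also have "\<dots> = ?a * s ^ 3 * ((a + x) * ?N) ^ 3 + 27 * (Z * (?N * b) ^ 3)"
    unfolding psi_b by Groebner_Basis.algebra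
  also have "\<dots> = ?a * s ^ 3 * dilate 3 c ^ 3 +
      fps_X ^ 1 * (9 * ?a * s ^ 3 * dilate 3 c ^ 2 * a ^ 2 * b) +
      fps_X ^ 2 * (18 * ?a * s ^ 3 * dilate 3 c ^ 2 * a * b ^ 2) +
      27 * (Z * (?N * b) ^ 3 + ?a * s ^ 3 * (dilate 3 c * p ^ 2 + p ^ 3))"
  proof -
    have x: "x = fps_X * b" by (simp add: x_def b_def)
    show ?thesis unfolding p unfolding p_def x by Groebner_Basis.algebra
  qed
  also have "\<dots> = dilate 3 (phi_neg * ?s ^ 3 * c ^ 3) +
      fps_X ^ 1 * dilate 3 (9 * phi_neg * ?s ^ 3 * c ^ 2 * ?a ^ 2 * omega) +
      fps_X ^ 2 * dilate 3 (18 * phi_neg * ?s ^ 3 * c ^ 2 * ?a * omega ^ 2) +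
      27 * (Z * (?N * b) ^ 3 + ?a * s ^ 3 * (dilate 3 c * p ^ 2 + p ^ 3))"
    by (simp add: dilate_simps a_def b_def s_def)
  finally have "section_fps 3 0 (dilate 3 (cubic_diff ^ 3 * omega ^ 3) * ?S) = phi_neg * ?s ^ 3 * c ^ 3 +
      section_fps 3 0 (27 * (Z * (?N * b) ^ 3 + ?a * s ^ 3 * (dilate 3 c * p ^ 2 + p ^ 3)))"
    by (simp only: section_fps_add section_fps_dilate zero_less_numeral section_fps_X_dilate) simp
  then have 1: "27 dvd cubic_diff ^ 3 * omega ^ 3 * ?W - phi_neg * ?s ^ 3 * c ^ 3"
    by (simp only: section_fps_dilate_mult zero_less_numeral) (simp add: section_fps_dvd)
  have "(psi * omega ^ 3) * ?a ^ 3 = (phi_neg * pent ^ 3) * omega ^ 3"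
    unfolding psi_phi_neg_pent[symmetric] by Groebner_Basis.algebra
  also have "\<dots> = phi_neg * (omega * pent) ^ 3" by Groebner_Basis.algebra
  also have "\<dots> = (phi_neg * ?s ^ 3) * ?a ^ 3" unfolding omega_pent by Groebner_Basis.algebra
  finally have "(psi * omega ^ 3) * ?a ^ 3 = (phi_neg * ?s ^ 3) * ?a ^ 3" .
  moreover have "?a \<noteq> 0" by (metis phi_neg_nth_0 dilate_nth dvd_0_right div_0 fps_zero_nth zero_less_numeral zero_neq_one)
  ultimately have "phi_neg * ?s ^ 3 = psi * omega ^ 3" by simp
  with 1 have "27 dvd (cubic_diff ^ 3 * ?W - psi * c ^ 3) * omega ^ 3"
    by (simp add: algebra_simps)
  then have 2: "27 dvd cubic_diff ^ 3 * ?W - psi * c ^ 3"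
    by (rule dvd_unit_cancel) (simp add: fps_nth_power_0)
  \<comment> \<open>The term of \<open>c ^ 3\<close> linear in \<open>k\<close> has coefficient 36,
    so \<open>k * psi\<close> matters only modulo 3, where cubing is the dilation by 3.\<close>
  have "3 dvd k * psi - cubic_diff * (fps_X * s)"
  proof -
    obtain u where u: "?a ^ 3 = a + 3 * u"
      using frobenius3[of ?a] by (auto simp: dilate_simps a_def elim!: dvdE) (metis diff_add_cancel add.commute)
    obtain v where v: "omega ^ 3 = b + 3 * v"
      using frobenius3[of omega] by (auto simp: b_def elim!: dvdE) (metis diff_add_cancel add.commute)
    have "(k * psi - cubic_diff * (fps_X * s)) * b = k * (psi * b) - cubic_diff * (fps_X * s) * b"
      by Groebner_Basis.algebra
    also have "\<dots> = fps_X * s * ((b + 3 * v) * a - (a + 3 * u) * b + 9 * (b + 3 * v) * (fps_X * b))"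
      unfolding psi_b cubic_diff_def k_def u v x_def b_def[symmetric] by Groebner_Basis.algebra
    also have "\<dots> = 3 * (fps_X * s * (v * a - u * b + 3 * (b + 3 * v) * (fps_X * b)))"
      by Groebner_Basis.algebra
    finally have "3 dvd (k * psi - cubic_diff * (fps_X * s)) * b" by (metis dvd_triv_left)
    then show ?thesis by (rule dvd_unit_cancel) (simp add: b_def dilate_nth)
  qed
  then obtain y where y: "k * psi - cubic_diff * (fps_X * s) = 3 * y" by (elim dvdE)
  \<comment> \<open>The higher terms of \<open>(cubic_diff + 12 k)^3\<close> vanish modulo 27, as
    \<open>3 * 12^2 = 27 * 16\<close> and \<open>12^3 = 27 * 64\<close>. Of the linear coefficient
    \<open>36 = 27 + 9\<close>, the 9 is absorbed by \<open>y\<close>.\<close>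
  have "27 dvd (cubic_diff ^ 3 * ?W - psi * c ^ 3) + 27 * (psi * (16 * cubic_diff * k ^ 2 + 64 * k ^ 3) + cubic_diff ^ 2 * y)"
    using 2 by (intro dvd_add) auto
  also have "\<dots> = cubic_diff ^ 3 * ?W - psi * c ^ 3 + 27 * (psi * (16 * cubic_diff * k ^ 2 + 64 * k ^ 3)) + 9 * cubic_diff ^ 2 * (3 * y)"
    by Groebner_Basis.algebra
  also have "\<dots> = (?W - (psi + 9 * (fps_X * s))) * cubic_diff ^ 3 - 27 * (cubic_diff ^ 2 * k * psi)"
    unfolding y[symmetric] c_def by Groebner_Basis.algebra
  finally have "27 dvd (?W - (psi + 9 * (fps_X * s))) * cubic_diff ^ 3 - 27 * (cubic_diff ^ 2 * k * psi)" by simp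
  then have "27 dvd (?W - (psi + 9 * (fps_X * s))) * cubic_diff ^ 3"
    by (metis dvd_diff_right_iff dvd_triv_left dvd_add_left_iff diff_add_cancel)
  then show ?thesis by (rule dvd_unit_cancel) (simp add: fps_nth_power_0 cubic_diff_nth_0)
qed

end

section \<open>Nonsquares and the three families of arguments\<close>

lemma v0_nonsquare_24:
  assumes "\<And>y::int. int (24 * m + 1) \<noteq> y\<^sup>2"
  shows "27 dvd v0 (4 * (24 * m + 1))"
proof -
  have "fps_nth psi (3 * m) = 0"
    using psi_nth_nonzero[of "3 * m"] assms by auto
  moreover have "27 dvd fps_nth psi_phi_quot (3 * m)"
    using psi_phi_quot_sections(1) unfolding numeral_dvd_fps by auto
  moreover have "v0 (4 * (24 * m + 1)) = fps_nth v0_gf32 (3 * m)"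
    by (simp add: v0_gf32_def algebra_simps)
  ultimately show ?thesis by (simp add: v0_gf32_eq)
qed

lemma three_dvd_square: "3 dvd (y::int)\<^sup>2 \<Longrightarrow> 3 dvd y"
  by (simp add: prime_dvd_power_iff)

text \<open>As \<open>36 (8 k + 1) = 32 (9 k + 1) + 4\<close>, three theta coefficients have to
  vanish. If one did not, \<open>8 k + 1\<close> would be a square: note
  \<open>8 (9 k + 1) + 1 = 9 (8 k + 1)\<close>, and \<open>8 k + 1 = 9 (8 l + 1)\<close> for
  \<open>k = 9 l + 1\<close>.\<close>

lemma v0_nonsquare_9:
  assumes ns: "\<And>y::int. int (8 * k + 1) \<noteq> y\<^sup>2"
  shows "27 dvd v0 (36 * (8 * k + 1))"
proof -
  have "fps_nth psi (9 * k + 1) = 0"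
  proof (rule ccontr)
    assume "fps_nth psi (9 * k + 1) \<noteq> 0"
    then obtain m where m: "int (8 * (9 * k + 1) + 1) = m\<^sup>2" by (rule psi_nth_nonzero)
    then have "m\<^sup>2 = 3 * (3 * int (8 * k + 1))" by simp
    then have "3 dvd m\<^sup>2" by (metis dvd_triv_left)
    then obtain l where "m = 3 * l" using three_dvd_square by (auto elim: dvdE)
    with m have "int (8 * k + 1) = l\<^sup>2" by (simp add: power2_eq_square)
    with ns show False by blast
  qed
  moreover have "fps_nth psi k = 0"
    using psi_nth_nonzero[of k] ns by auto
  moreover have "fps_nth (fps_X * dilate 9 psi) k = 0"
  proof (rule ccontr)
    assume *: "fps_nth (fps_X * dilate 9 psi) k \<noteq> 0"
    then have "k \<noteq> 0" by (intro notI) simp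
    with * have "fps_nth (dilate 9 psi) (k - 1) \<noteq> 0" by (simp add: fps_X_mult_nth)
    then have "9 dvd k - 1" "fps_nth psi ((k - 1) div 9) \<noteq> 0"
      by (auto simp: dilate_nth split: if_splits)
    then obtain l where l: "k - 1 = 9 * l" "fps_nth psi l \<noteq> 0" by (auto elim!: dvdE)
    then obtain m where "int (8 * l + 1) = m\<^sup>2" using psi_nth_nonzero by blast
    then have "int (8 * k + 1) = (3 * m)\<^sup>2"
      using l \<open>k \<noteq> 0\<close> by (simp add: power_mult_distrib flip: \<open>int (8 * l + 1) = m\<^sup>2\<close>)
    with ns show False by blast
  qed
  moreover have "27 dvd fps_nth (section_fps 3 0 (section_fps 3 1 psi_phi_quot) - (psi + 9 * (fps_X * dilate 9 psi))) k"
    using psi_phi_quot_section10 unfolding numeral_dvd_fps by blast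
  ultimately have "27 dvd fps_nth psi_phi_quot (9 * k + 1)"
    by (simp add: mult.assoc)
  moreover have "v0 (36 * (8 * k + 1)) = fps_nth v0_gf32 (9 * k + 1)"
    by (simp add: v0_gf32_def algebra_simps)
  ultimately show ?thesis using \<open>fps_nth psi (9 * k + 1) = 0\<close> by (simp add: v0_gf32_eq)
qed

lemma square_of_square_mult:
  fixes M y c :: int
  assumes "c\<^sup>2 * M = y\<^sup>2" "c \<noteq> 0"
  shows "\<exists>z. M = z\<^sup>2"
proof -
  have "c\<^sup>2 dvd y\<^sup>2" using assms(1) by (metis dvd_triv_left)
  then have "c dvd y" by (simp add: pow_divides_pow_iff)
  then obtain z where "y = c * z" by (elim dvdE)
  with assms have "M = z\<^sup>2" by (simp add: power_mult_distrib)
  then show ?thesis ..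
qed

text \<open>Multiplying by a nonzero square preserves being a nonsquare. Units modulo 24 have square
  1, so \<open>p \<noteq> 3\<close> stays in the family \<open>24 m + 1\<close>; for
  \<open>p = 3\<close> and \<open>\<alpha> > 0\<close> one factor 9 is split off and the rest is
  still 1 modulo 8.\<close>

lemma v0_nonsquare:
  fixes p \<alpha> M :: nat
  assumes "prime p" "p \<ge> 3" "M mod 24 = 1" and ns: "\<And>y::int. int M \<noteq> y\<^sup>2"
  shows "27 dvd v0 (p ^ (2 * \<alpha>) * (4 * M))"
proof -
  have ns': "int (c\<^sup>2 * M) \<noteq> y\<^sup>2" if "c > 0" for c :: nat and y :: int
  proof
    assume "int (c\<^sup>2 * M) = y\<^sup>2"
    then have "(int c)\<^sup>2 * int M = y\<^sup>2" by simp
    with square_of_square_mult[of "int c" "int M" y] that ns show False by auto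
  qed
  have p24: "(p ^ \<alpha>)\<^sup>2 mod 24 = 1" if "p \<noteq> 3"
  proof -
    have "\<not> 2 dvd p" "\<not> 3 dvd p"
      using assms(1,2) that by (auto simp: prime_nat_iff)
    then have "p mod 24 \<in> {1, 5, 7, 11, 13, 17, 19, 23}"
      unfolding insert_iff empty_iff by presburger
    then have "(p mod 24)\<^sup>2 mod 24 = 1" by auto
    then have "p\<^sup>2 mod 24 = 1" by (simp add: power_mod)
    then have "(p\<^sup>2 mod 24) ^ \<alpha> mod 24 = 1" by simp
    then have "(p\<^sup>2) ^ \<alpha> mod 24 = 1" unfolding power_mod .
    then show ?thesis by (simp add: mult.commute flip: power_mult)
  qed
  show ?thesis
  proof (cases "p = 3 \<and> \<alpha> > 0")
    case False
    have "((p ^ \<alpha>)\<^sup>2 * M) mod 24 = 1"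
    proof (cases "\<alpha> = 0")
      case True
      then show ?thesis using assms(3) by simp
    next
      case False
      with \<open>\<not> (p = 3 \<and> \<alpha> > 0)\<close> have "p \<noteq> 3" by simp
      from p24[OF this] assms(3) have "((p ^ \<alpha>)\<^sup>2 mod 24) * (M mod 24) mod 24 = 1" by simp
      then show ?thesis unfolding mod_mult_eq .
    qed
    then obtain m where m: "(p ^ \<alpha>)\<^sup>2 * M = 24 * m + 1" by (metis mult_div_mod_eq)
    have "27 dvd v0 (4 * (24 * m + 1))"
      unfolding m[symmetric]
      by (rule v0_nonsquare_24[of m, folded m]) (rule ns', use assms(2) in simp)
    moreover have "p ^ (2 * \<alpha>) * (4 * M) = 4 * (24 * m + 1)"
      unfolding m[symmetric] by (simp add: mult.commute flip: power_mult)
    ultimately show ?thesis by simp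
  next
    case True
    then obtain \<beta> where \<beta>: "\<alpha> = Suc \<beta>" "p = 3" using gr0_implies_Suc by blast
    have "((9::nat) mod 8) ^ \<beta> mod 8 = 1" by simp
    then have "(9::nat) ^ \<beta> mod 8 = 1" unfolding power_mod .
    moreover have "M mod 8 = 1" using assms(3) by presburger
    ultimately have "((9::nat) ^ \<beta> mod 8) * (M mod 8) mod 8 = 1" by simp
    then have "(9 ^ \<beta> * M) mod 8 = 1" unfolding mod_mult_eq .
    then obtain k where k: "9 ^ \<beta> * M = 8 * k + 1" by (metis mult_div_mod_eq)
    have "9 ^ \<beta> = ((3::nat) ^ \<beta>)\<^sup>2" by (simp add: power2_eq_square flip: power_mult_distrib)
    then have "27 dvd v0 (36 * (8 * k + 1))"
      unfolding k[symmetric]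
      by (intro v0_nonsquare_9[of k, folded k]) (simp only: \<open>9 ^ \<beta> = (3 ^ \<beta>)\<^sup>2\<close>, rule ns', simp)
    moreover have "p ^ (2 * \<alpha>) * (4 * M) = 36 * (8 * k + 1)"
      unfolding k[symmetric] \<beta> by (simp add: power_mult)
    ultimately show ?thesis by simp
  qed
qed

text \<open>The root is prime to 6, so \<open>y\<close> or \<open>- y\<close> has the form
  \<open>6 k + 1\<close>, and \<open>(6 k + 1)^2 = 12 k (3 k + 1) + 1\<close>.\<close>

lemma pentagonal_of_square:
  assumes "int (24 * n + 1) = y\<^sup>2"
  shows "\<exists>k::int. int n = k * (3 * k + 1) div 2"
proof -
  have *: "\<exists>k::int. int n = k * (3 * k + 1) div 2" if "y = 6 * k + 1" "int (24 * n + 1) = y\<^sup>2" for k y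
  proof -
    have "24 * int n = 12 * (k * (3 * k + 1))" using that by (simp add: power2_eq_square algebra_simps)
    then have "k * (3 * k + 1) = 2 * int n" by simp
    then have "int n = k * (3 * k + 1) div 2" by simp
    then show ?thesis ..
  qed
  have "odd (y\<^sup>2)" "\<not> 3 dvd y\<^sup>2" unfolding assms[symmetric] by presburger+
  then have "odd y" "\<not> 3 dvd y" by (auto simp: power2_eq_square)
  then have "y mod 6 = 1 \<or> y mod 6 = 5" by presburger
  then show ?thesis
  proof
    assume "y mod 6 = 1"
    then have "y = 6 * (y div 6) + 1" using div_mult_mod_eq[of y 6] by linarith
    then show ?thesis using * assms by blast
  next
    assume "y mod 6 = 5"
    then obtain d where "y = 6 * d + 5" by (metis mult_div_mod_eq)
    then have "- y = 6 * (- d - 1) + 1" by simp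
    moreover have "int (24 * n + 1) = (- y)\<^sup>2" using assms by simp
    ultimately show ?thesis using * by blast
  qed
qed

theorem theorem5p6:
  fixes p p1 n \<alpha> :: nat
  assumes "prime p" and "p \<ge> 3"
    and "prime p1" and "p1 \<ge> 5"
  shows "((\<forall>k::int. int n \<noteq> k * (3 * k + 1) div 2) \<longrightarrow>
            [v0 (p ^ (2 * \<alpha>) * (96 * n + 4)) = 0] (mod 27)) \<and>
         (\<forall>i\<in>{1..p1 - 1}.
            [v0 (p ^ (2 * \<alpha>) * p1 * (96 * p1 * n + 96 * i + 4 * p1)) = 0] (mod 27)) \<and>
         (\<forall>j::nat. \<not> QuadRes (int p1) (int (24 * j + 1)) \<longrightarrow>
            [v0 (p ^ (2 * \<alpha>) * (96 * p1 * n + 96 * j + 4)) = 0] (mod 27))"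
proof (intro conjI impI ballI allI)
  assume np: "\<forall>k::int. int n \<noteq> k * (3 * k + 1) div 2"
  have "27 dvd v0 (p ^ (2 * \<alpha>) * (4 * (24 * n + 1)))"
    by (rule v0_nonsquare) (use assms np pentagonal_of_square[of n] in auto)
  then show "[v0 (p ^ (2 * \<alpha>) * (96 * n + 4)) = 0] (mod 27)"
    by (simp add: cong_0_iff algebra_simps)
next
  fix i assume i: "i \<in> {1..p1 - 1}"
  \<comment> \<open>If \<open>M\<close> were a square, its divisor \<open>p1\<close> would divide it
    twice, hence divide \<open>24 * i\<close>; this is impossible for \<open>p1 \<ge> 5\<close> and
    \<open>0 < i < p1\<close>.\<close>
  define M where "M = p1 * (24 * (p1 * n + i) + p1)"
  have "27 dvd v0 (p ^ (2 * \<alpha>) * (4 * M))"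
  proof (rule v0_nonsquare)
    have "\<not> 2 dvd p1" "\<not> 3 dvd p1"
      using assms(3,4) by (auto simp: prime_nat_iff)
    then have "p1 mod 24 \<in> {1, 5, 7, 11, 13, 17, 19, 23}"
      unfolding insert_iff empty_iff by presburger
    then have "(p1 mod 24)\<^sup>2 mod 24 = 1" by auto
    then have "p1\<^sup>2 mod 24 = 1" by (simp add: power_mod)
    moreover have "M = p1\<^sup>2 + 24 * (p1 * (p1 * n + i))"
      by (simp add: M_def power2_eq_square algebra_simps)
    ultimately show "M mod 24 = 1" by simp
    fix y :: int
    show "int M \<noteq> y\<^sup>2"
    proof
      assume y: "int M = y\<^sup>2"
      have pr: "prime (int p1)" using assms(3) by simp
      have "int p1 dvd y\<^sup>2" unfolding y[symmetric] M_def by simp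
      then have "int p1 dvd y" using prime_dvd_power[OF pr] by blast
      then have "int p1 * int p1 dvd y\<^sup>2" unfolding power2_eq_square by (intro mult_dvd_mono)
      then have "p1 * p1 dvd M" unfolding y[symmetric] by (simp flip: of_nat_mult)
      then have "p1 dvd 24 * (p1 * n + i) + p1" using assms(4) by (simp add: M_def)
      then have "p1 dvd 24 * i" by (simp add: algebra_simps dvd_add_left_iff dvd_add_right_iff)
      then have "p1 dvd 24 \<or> p1 dvd i" using assms(3) prime_dvd_mult_iff by blast
      then show False
      proof
        assume "p1 dvd 24"
        then have "p1 dvd 2 ^ 3 * 3" by simp
        then have "p1 dvd 2 \<or> p1 dvd 3" using assms(3) prime_dvd_mult_iff prime_dvd_power by blast
        then show False using assms(4) by (auto dest: dvd_imp_le)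
      next
        assume "p1 dvd i"
        then show False using i by (auto dest: dvd_imp_le)
      qed
    qed
  qed (use assms in auto)
  then show "[v0 (p ^ (2 * \<alpha>) * p1 * (96 * p1 * n + 96 * i + 4 * p1)) = 0] (mod 27)"
    by (simp add: cong_0_iff M_def algebra_simps)
next
  \<comment> \<open>A square root of \<open>24 * (p1 * n + j) + 1\<close> would be a square root of
    \<open>24 * j + 1\<close> modulo \<open>p1\<close>.\<close>
  fix j assume j: "\<not> QuadRes (int p1) (int (24 * j + 1))"
  have "27 dvd v0 (p ^ (2 * \<alpha>) * (4 * (24 * (p1 * n + j) + 1)))"
  proof (rule v0_nonsquare)
    fix y :: int
    show "int (24 * (p1 * n + j) + 1) \<noteq> y\<^sup>2"
    proof
      assume y: "int (24 * (p1 * n + j) + 1) = y\<^sup>2"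
      have "y\<^sup>2 - int (24 * j + 1) = int p1 * (24 * int n)"
        unfolding y[symmetric] by (simp add: algebra_simps)
      then have "[y\<^sup>2 = int (24 * j + 1)] (mod int p1)"
        by (metis cong_iff_dvd_diff dvd_triv_left)
      then show False using j unfolding QuadRes_def by blast
    qed
  qed (use assms in auto)
  then show "[v0 (p ^ (2 * \<alpha>) * (96 * p1 * n + 96 * j + 4)) = 0] (mod 27)"
    by (simp add: cong_0_iff algebra_simps)
qed

end
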